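(* Let $\phi(z)=1+B_1z+B_2z^2+\cdots$ be a Ma-Minda function that is convex in $\mathbb{D}$, and let $\psi(z)=1+\sum_{m\ge1}c_mz^m$ be the solution (with $\psi(0)=1$) of the differential equation $$\psi(z)+\frac{z\psi'(z)}{\psi(z)}=\phi(z).$$ Let $f\in\mathcal{C}(\phi)$ have logarithmic coefficients $\gamma_m$. (1) If $\psi$ is convex, then $$|\gamma_m|\le\frac{|B_1|}{4m}\quad(m\in\mathbb{N}),\qquad \sum_{m=1}^{n}|\gamma_m|^2\le\frac14\sum_{m=1}^{n}\frac{|c_m|^2}{m^2}\quad(n\in\mathbb{N}),\qquad \sum_{m=1}^{\infty}|\gamma_m|^2\le\frac14\sum_{m=1}^{\infty}\frac{|c_m|^2}{m^2}.$$ (2) If $\psi$ is starlike with respect to $1$, then $$|\gamma_m|\le\frac{|B_1|}{4}\quad(m\in\mathbb{N}).$$ The first and third inequalities in (1) and the inequality in (2) are sharp (best possible in $\mathcal{C}(\phi)$) in the case when the function $f\in\mathcal{A}$ defined by $zf'(z)/f(z)=\psi(z)$ is extremal for them, i.e. attains equality.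
   Context: $\mathbb{D}=\{|z|<1\}$. $\mathcal{A}$ is the class of analytic functions $f(z)=z+\sum_{m\ge2}a_mz^m$ on $\mathbb{D}$. A Ma-Minda function is an analytic univalent function $\phi$ on $\mathbb{D}$ with $\Re\phi>0$, $\phi(0)=1$, $\phi'(0)>0$, and $\phi(\mathbb{D})$ symmetric about the real axis. A function is called convex (resp. starlike with respect to $1$) in $\mathbb{D}$ if it is analytic and univalent in $\mathbb{D}$ and its image is convex (resp. starlike with respect to the point $1$). $u\prec v$ means $u=v\circ w$ for some analytic $w:\mathbb{D}\to\mathbb{D}$ with $w(0)=0$. $\mathcal{C}(\phi)=\{f\in\mathcal{A}: 1+zf''(z)/f'(z)\prec\phi(z)\}$. The logarithmic coefficients $\gamma_m$ of $f$ are defined by $\log(f(z)/z)=2\sum_{m=1}^{\infty}\gamma_mz^m$ (branch vanishing at $0$). *)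

theory Defs
  imports "HOL-Complex_Analysis.Complex_Analysis"
begin

abbreviation unit_disc :: "complex set" where
  "unit_disc \<equiv> ball 0 1"

definition normalized_analytic :: "(complex \<Rightarrow> complex) set" where
  "normalized_analytic = {f. f holomorphic_on unit_disc \<and> f 0 = 0 \<and> deriv f 0 = 1}"

definition ma_minda :: "(complex \<Rightarrow> complex) \<Rightarrow> bool" where
  "ma_minda \<phi> \<longleftrightarrow>
     \<phi> holomorphic_on unit_disc \<and> inj_on \<phi> unit_disc \<and>
     (\<forall>z\<in>unit_disc. Re (\<phi> z) > 0) \<and> \<phi> 0 = 1 \<and>
     deriv \<phi> 0 \<in> \<real> \<and> Re (deriv \<phi> 0) > 0 \<and>
     cnj ` (\<phi> ` unit_disc) = \<phi> ` unit_disc"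

definition convex_function :: "(complex \<Rightarrow> complex) \<Rightarrow> bool" where
  "convex_function f \<longleftrightarrow>
     f holomorphic_on unit_disc \<and> inj_on f unit_disc \<and> convex (f ` unit_disc)"

definition starlike_function_wrt :: "complex \<Rightarrow> (complex \<Rightarrow> complex) \<Rightarrow> bool" where
  "starlike_function_wrt a f \<longleftrightarrow>
     f holomorphic_on unit_disc \<and> inj_on f unit_disc \<and>
     a \<in> f ` unit_disc \<and> (\<forall>w\<in>f ` unit_disc. closed_segment a w \<subseteq> f ` unit_disc)"

definition subordinate :: "(complex \<Rightarrow> complex) \<Rightarrow> (complex \<Rightarrow> complex) \<Rightarrow> bool" where
  "subordinate u v \<longleftrightarrow>
     (\<exists>w. w holomorphic_on unit_disc \<and> w ` unit_disc \<subseteq> unit_disc \<and> w 0 = 0 \<and>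
          (\<forall>z\<in>unit_disc. u z = v (w z)))"

text \<open>Here and below, denominators are required not to vanish wherever a quotient is formed,
  since division by zero is total in HOL.\<close>

definition class_C :: "(complex \<Rightarrow> complex) \<Rightarrow> (complex \<Rightarrow> complex) set" where
  "class_C \<phi> =
     {f \<in> normalized_analytic.
        (\<forall>z\<in>unit_disc. deriv f z \<noteq> 0) \<and>
        subordinate (\<lambda>z. 1 + z * deriv (deriv f) z / deriv f z) \<phi>}"

definition briot_bouquet_solution :: "(complex \<Rightarrow> complex) \<Rightarrow> (complex \<Rightarrow> complex) \<Rightarrow> bool" where
  "briot_bouquet_solution \<phi> \<psi> \<longleftrightarrow>
     \<psi> holomorphic_on unit_disc \<and> \<psi> 0 = 1 \<and>
     (\<forall>z\<in>unit_disc. \<psi> z \<noteq> 0 \<and> \<psi> z + z * deriv \<psi> z / \<psi> z = \<phi> z)"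

text \<open>The functions \<open>f\<close> in \<open>normalized_analytic\<close> with \<open>z f'(z) / f(z) = \<psi>(z)\<close>; the quotient has a
  removable singularity at \<open>0\<close>.\<close>

definition has_log_derivative :: "(complex \<Rightarrow> complex) \<Rightarrow> (complex \<Rightarrow> complex) \<Rightarrow> bool" where
  "has_log_derivative f \<psi> \<longleftrightarrow>
     f \<in> normalized_analytic \<and>
     (\<forall>z\<in>unit_disc - {0}. f z \<noteq> 0 \<and> z * deriv f z / f z = \<psi> z)"

text \<open>Since \<open>f(z) / z\<close> tends to \<open>1\<close> at \<open>0\<close>, the branch of \<open>log (f(z) / z)\<close> vanishing at \<open>0\<close> agrees
  near \<open>0\<close> with the principal one, and its Taylor coefficients at \<open>0\<close> can be read off there.
  Lemma \<open>log_coeff_sums\<close> is the defining expansion for the branch on the whole disc.\<close>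

definition log_coeff :: "(complex \<Rightarrow> complex) \<Rightarrow> nat \<Rightarrow> complex" where
  "log_coeff f m =
     fps_nth (fps_expansion (\<lambda>z. if z = 0 then 0 else Ln (f z / z)) 0) m / 2"

lemma log_coeff_sums:
  assumes "L holomorphic_on unit_disc" "L 0 = 0"
    and "\<And>z. z \<in> unit_disc \<Longrightarrow> f z = z * exp (L z)"
    and "z \<in> unit_disc"
  shows "(\<lambda>m. 2 * log_coeff f m * z ^ m) sums L z"
proof -
  let ?g = "\<lambda>z. if z = 0 then 0 else Ln (f z / z)"
  have "isCont L 0"
    using assms(1) by (metis centre_in_ball continuous_on_eq_continuous_at
        holomorphic_on_imp_continuous_on open_ball zero_less_one)
  then have "L \<midarrow>0\<rightarrow> 0"
    using assms(2) by (simp add: isCont_def)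
  then have "\<forall>\<^sub>F w in at 0. norm (L w) < pi"
    using order_tendstoD(2)[of "\<lambda>w. norm (L w)" 0 "at 0" pi] tendsto_norm_zero pi_gt_zero by blast
  then have "\<forall>\<^sub>F w in nhds 0. norm (L w) < pi"
    using assms(2) by (simp add: eventually_nhds_conv_at)
  moreover have "\<forall>\<^sub>F w in nhds (0::complex). w \<in> unit_disc"
    by (rule eventually_nhds_in_open) auto
  ultimately have "\<forall>\<^sub>F w in nhds 0. ?g w = L w"
  proof eventually_elim
    case (elim w)
    have "\<bar>Im (L w)\<bar> < pi"
      using abs_Im_le_cmod[of "L w"] elim(1) by linarith
    then have "Ln (exp (L w)) = L w"
      by (intro Ln_exp) auto
    then show ?case
      using assms(2) assms(3)[OF elim(2)] by auto
  qed
  then have "(deriv ^^ m) ?g 0 = (deriv ^^ m) L 0" for m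
    by (rule higher_deriv_cong_ev) simp
  then have "2 * log_coeff f m = (deriv ^^ m) L 0 / fact m" for m
    by (simp add: log_coeff_def fps_expansion_def)
  then show ?thesis
    using holomorphic_power_series[OF assms(1,4)] by simp
qed

definition best_possible_bound :: "'a set \<Rightarrow> ('a \<Rightarrow> real) \<Rightarrow> real \<Rightarrow> bool" where
  "best_possible_bound K S b \<longleftrightarrow>
     (\<forall>g\<in>K. S g \<le> b) \<and> (\<forall>M. (\<forall>g\<in>K. S g \<le> M) \<longrightarrow> b \<le> M)"

end

theory Submission
  imports Defs
begin

text \<open>
  Writing \<open>p(z) = z f'(z) / f(z)\<close>, membership in \<open>class_C \<phi>\<close> says \<open>p + z p' / p \<prec> \<phi>\<close>, and
  \<open>\<psi>\<close> solves the corresponding equation, so a first-contact argument with Jack's lemma gives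
  \<open>p \<prec> \<psi>\<close>. Since \<open>2 m \<gamma>\<^sub>m\<close> is the \<open>m\<close>-th coefficient of \<open>p\<close>, the bounds are those of Rogosinski for
  subordinate functions. Geometry enters only through the inequality
  \<open>Re ((G z - G \<zeta>) / (\<zeta> G' \<zeta>)) < 0\<close> for \<open>\<bar>z\<bar> \<le> \<bar>\<zeta>\<bar>\<close>, \<open>z \<noteq> \<zeta>\<close> (the half-plane at the boundary point \<open>G \<zeta>\<close> with
  outer normal \<open>\<zeta> G' \<zeta>\<close> contains \<open>G z\<close>), which holds for \<open>G\<close> convex. When \<open>\<psi>\<close> is only starlike,
  \<open>G = \<integral> (\<psi> - 1) / z\<close> is convex and dominates \<open>log (f(z) / z) = \<integral> (p - 1) / z\<close>.
\<close>

section \<open>Variations of univalent functions\<close>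

text \<open>Two obstacles shape the proof. That p is holomorphic is not given:
  \<open>f(z) / z\<close> must first be shown to have no zeros, which takes a subordination argument
  of its own on the disc reaching up to a hypothetical nearest zero. And \<phi> and \<psi> need not
  extend to the boundary of the disc; so every geometric inequality is stated at interior points,
  where it comes from the Schwarz lemma applied to variations of a function inside its own image or
  from a circle inside the disc. Strictness of these inequalities matters because the factor m in
  Jack's lemma may equal 1. The constants come from B_1 = 2 c_1: the convex case gives 2 m |gamma_m|
  <= |c_1|, the starlike case 2 |gamma_m| <= |G'(0)| = |c_1|. The latter lacks the factor 1/m
  because it bounds the coefficients of the logarithm itself and not those of p.\<close>

lemma Re_of_real_mult: "Re (of_real r * x) = r * Re x"
  by simp

lemma has_real_derivative_inner_self:
  fixes q :: "real \<Rightarrow> 'a::real_inner"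
  assumes q: "(q has_vector_derivative d) (at t)"
  shows "((\<lambda>t. q t \<bullet> q t) has_real_derivative 2 * (q t \<bullet> d)) (at t)"
  using has_derivative_inner[OF q[unfolded has_vector_derivative_def] q[unfolded has_vector_derivative_def]]
  by (simp add: has_field_derivative_def inner_commute algebra_simps mult_commute_abs)

text \<open>The squared modulus has derivative 2 Re (cnj (q 0) d) at 0; if that were positive, it
  would increase just to the right of 0.\<close>

lemma norm_le_imp_Re_deriv_nonpos:
  fixes q :: "real \<Rightarrow> complex"
  assumes q: "(q has_vector_derivative d) (at 0)" and "e > 0"
    and le: "\<And>t. \<lbrakk>0 \<le> t; t < e\<rbrakk> \<Longrightarrow> norm (q t) \<le> norm (q 0)"
  shows "Re (cnj (q 0) * d) \<le> 0"
proof (rule ccontr)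
  assume neg: "\<not> ?thesis"
  have "((\<lambda>t. q t \<bullet> q t) has_real_derivative 2 * (q 0 \<bullet> d)) (at 0)"
    by (rule has_real_derivative_inner_self[OF q])
  moreover have "2 * (q 0 \<bullet> d) > 0"
    using neg by (simp add: inner_complex_def)
  ultimately obtain e' where e': "e' > 0" "\<And>h. \<lbrakk>0 < h; h < e'\<rbrakk> \<Longrightarrow> q 0 \<bullet> q 0 < q h \<bullet> q h"
    using DERIV_pos_inc_right[of "\<lambda>t. q t \<bullet> q t" "2 * (q 0 \<bullet> d)" 0] by auto
  define h where "h = min e e' / 2"
  have "h > 0" "h < e" "h < e'"
    using e' \<open>e > 0\<close> by (auto simp: h_def)
  then have "norm (q 0) < norm (q h)" "norm (q h) \<le> norm (q 0)"
    using e'(2)[of h] le[of h] by (auto simp: norm_eq_sqrt_inner)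
  then show False by simp
qed

text \<open>Maximum principle for exp H: if Re H reached 0 inside the disc, exp H would be constant,
  contrary to its modulus at 0.\<close>

lemma Re_neg_of_nonpos:
  assumes H: "H holomorphic_on unit_disc" and le: "\<And>z. z \<in> unit_disc \<Longrightarrow> Re (H z) \<le> 0"
    and H0: "Re (H 0) < 0" and z: "z \<in> unit_disc"
  shows "Re (H z) < 0"
proof (rule ccontr)
  assume "\<not> Re (H z) < 0"
  then have "Re (H z) = 0"
    using le[OF z] by simp
  then have "(\<lambda>z. exp (H z)) constant_on unit_disc"
    using H le z
    by (intro maximum_modulus_principle[where U = unit_disc and \<xi> = z])
       (auto intro!: holomorphic_intros)
  then have "norm (exp (H z)) = norm (exp (H 0))"
    using z unfolding constant_on_def by (metis centre_in_ball zero_less_one)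
  then show False
    using H0 \<open>Re (H z) = 0\<close> by simp
qed

lemma subordinateE:
  assumes "subordinate p q"
  obtains w where "w holomorphic_on unit_disc" "\<And>z. z \<in> unit_disc \<Longrightarrow> norm (w z) \<le> norm z"
    "\<And>z. z \<in> unit_disc \<Longrightarrow> p z = q (w z)"
proof -
  obtain w where w: "w holomorphic_on unit_disc" "w ` unit_disc \<subseteq> unit_disc" "w 0 = 0"
     "\<forall>z\<in>unit_disc. p z = q (w z)"
    using assms by (auto simp: subordinate_def)
  have "norm (w z) \<le> norm z" if "z \<in> unit_disc" for z
    by (rule Schwarz_Lemma(1)[OF w(1,3)]) (use w(2) that in \<open>auto simp: image_subset_iff\<close>)
  then show ?thesis using that w by auto
qed

text \<open>The Schwarz function is the holomorphic inverse of \<open>q\<close> composed with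
  \<open>p\<close>; it fixes 0 because \<open>p 0 = q 0\<close>.\<close>

lemma subordinateI_univalent:
  assumes p: "p holomorphic_on unit_disc" and q: "q holomorphic_on unit_disc" "inj_on q unit_disc"
    and 0: "p 0 = q 0" and sub: "\<And>z. z \<in> unit_disc \<Longrightarrow> p z \<in> q ` unit_disc"
  shows "subordinate p q"
proof -
  obtain h where h: "h holomorphic_on q ` unit_disc" "\<And>z. z \<in> unit_disc \<Longrightarrow> h (q z) = z"
    using holomorphic_has_inverse[OF q(1) open_ball q(2)] by metis
  have "(h \<circ> p) holomorphic_on unit_disc"
    using sub by (intro holomorphic_on_compose_gen[OF p h(1)]) auto
  then show ?thesis
    unfolding subordinate_def using sub h(2) 0
    by (intro exI[of _ "\<lambda>z. h (p z)"]) (force simp: o_def)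
qed

text \<open>The derivative at \<open>t = 0\<close> of the Schwarz lemma for \<open>\<phi>\<inverse> \<circ> (\<phi> + t u)\<close>.\<close>

lemma univalent_variation:
  assumes hol: "\<phi> holomorphic_on unit_disc" and inj: "inj_on \<phi> unit_disc"
    and u: "u holomorphic_on unit_disc" "u 0 = 0"
    and sub: "\<And>z t. \<lbrakk>z \<in> unit_disc; 0 \<le> t; t \<le> 1\<rbrakk> \<Longrightarrow> \<phi> z + of_real t * u z \<in> \<phi> ` unit_disc"
    and \<zeta>: "\<zeta> \<in> unit_disc" "\<zeta> \<noteq> 0"
  shows "Re (u \<zeta> / (\<zeta> * deriv \<phi> \<zeta>)) \<le> 0"
proof -
  obtain h where h: "h holomorphic_on \<phi> ` unit_disc"
      "\<And>z. z \<in> unit_disc \<Longrightarrow> deriv \<phi> z * deriv h (\<phi> z) = 1"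
      "\<And>z. z \<in> unit_disc \<Longrightarrow> h (\<phi> z) = z"
    using holomorphic_has_inverse[OF hol _ inj] by auto
  have op: "open (\<phi> ` unit_disc)"
    using open_mapping_thm3[OF hol _ inj] by auto
  \<comment> \<open>Since \<open>h\<close> inverts \<phi>, this curve follows the value at \<zeta>
    of the Schwarz function belonging to \<open>\<phi> + t u\<close>. It starts at \<zeta> and stays
    in the closed disc of radius |\<zeta>|.\<close>
  define q where "q = (\<lambda>t::real. h (\<phi> \<zeta> + of_real t * u \<zeta>))"
  have le: "norm (q t) \<le> norm \<zeta>" if t: "0 \<le> t" "t < 1" for t
  proof -
    have "subordinate (\<lambda>z. \<phi> z + of_real t * u z) \<phi>"
      using sub t u(2) by (intro subordinateI_univalent[OF _ hol inj] holomorphic_intros hol u(1)) auto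
    then obtain w where w: "\<And>z. z \<in> unit_disc \<Longrightarrow> norm (w z) \<le> norm z"
      "\<And>z. z \<in> unit_disc \<Longrightarrow> \<phi> z + of_real t * u z = \<phi> (w z)"
      by (rule subordinateE) (rule that)
    have "w \<zeta> \<in> unit_disc" using w(1)[OF \<zeta>(1)] \<zeta>(1) by simp
    then have "q t = w \<zeta>" using h(3) by (simp add: q_def w(2)[OF \<zeta>(1)])
    then show ?thesis using w(1)[OF \<zeta>(1)] by simp
  qed
  have "(h has_field_derivative deriv h (\<phi> \<zeta>)) (at (\<phi> \<zeta> + of_real 0 * u \<zeta>))"
    using h(1) op \<zeta> by (auto intro!: holomorphic_derivI)
  moreover have "((\<lambda>t. \<phi> \<zeta> + of_real t * u \<zeta>) has_vector_derivative u \<zeta>) (at 0)"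
    by (auto intro!: derivative_eq_intros simp: scaleR_conv_of_real)
  ultimately have "(q has_vector_derivative u \<zeta> * deriv h (\<phi> \<zeta>)) (at 0)"
    using field_vector_diff_chain_at[of "\<lambda>t::real. \<phi> \<zeta> + of_real t * u \<zeta>" "u \<zeta>" 0 h]
    by (simp add: q_def o_def)
  then have "Re (cnj (q 0) * (u \<zeta> * deriv h (\<phi> \<zeta>))) \<le> 0"
    using le h(3)[OF \<zeta>(1)] by (intro norm_le_imp_Re_deriv_nonpos[where e = 1]) (auto simp: q_def)
  moreover have "cnj (q 0) * (u \<zeta> * deriv h (\<phi> \<zeta>)) = of_real ((norm \<zeta>)\<^sup>2) * (u \<zeta> / (\<zeta> * deriv \<phi> \<zeta>))"
  proof -
    have "deriv h (\<phi> \<zeta>) = 1 / deriv \<phi> \<zeta>"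
      using h(2)[OF \<zeta>(1)] by (metis mult_eq_0_iff nonzero_mult_div_cancel_left zero_neq_one)
    moreover have "deriv \<phi> \<zeta> \<noteq> 0" using h(2)[OF \<zeta>(1)] by auto
    ultimately show ?thesis
      using \<zeta> h(3)[OF \<zeta>(1)] by (simp add: q_def complex_norm_square field_simps del: of_real_power)
  qed
  ultimately have "(norm \<zeta>)\<^sup>2 * Re (u \<zeta> / (\<zeta> * deriv \<phi> \<zeta>)) \<le> 0"
    by (simp only: Re_of_real_mult)
  then show ?thesis
    using \<zeta> by (simp add: mult_le_0_iff)
qed

lemma holomorphic_divide_at_zero:
  assumes u: "u holomorphic_on unit_disc" "u 0 = 0"
  obtains v where "v holomorphic_on unit_disc" "\<And>z. z \<in> unit_disc \<Longrightarrow> u z = z * v z" "v 0 = deriv u 0"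
proof
  let ?v = "\<lambda>z. if z = 0 then deriv u 0 else u z / z"
  show "?v holomorphic_on unit_disc"
    using pole_theorem_open[OF u(1), of 0 "\<lambda>z. u z / z"] u(2) by (simp cong: if_cong)
  show "u z = z * ?v z" for z
    using u by auto
qed simp

text \<open>The quotient extends holomorphically to 0 with the value
  \<open>deriv u 0 / deriv \<phi> 0\<close>, so strictness at 0 spreads over the disc by the maximum
  principle.\<close>

lemma univalent_variation_strict:
  assumes hol: "\<phi> holomorphic_on unit_disc" and inj: "inj_on \<phi> unit_disc"
    and u: "u holomorphic_on unit_disc" "u 0 = 0"
    and sub: "\<And>z t. \<lbrakk>z \<in> unit_disc; 0 \<le> t; t \<le> 1\<rbrakk> \<Longrightarrow> \<phi> z + of_real t * u z \<in> \<phi> ` unit_disc"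
    and neg: "Re (deriv u 0 / deriv \<phi> 0) < 0"
    and \<zeta>: "\<zeta> \<in> unit_disc" "\<zeta> \<noteq> 0"
  shows "Re (u \<zeta> / (\<zeta> * deriv \<phi> \<zeta>)) < 0"
proof -
  obtain v where v: "v holomorphic_on unit_disc" "\<And>z. z \<in> unit_disc \<Longrightarrow> u z = z * v z" "v 0 = deriv u 0"
    using holomorphic_divide_at_zero[OF u] by blast
  have nz: "deriv \<phi> z \<noteq> 0" if "z \<in> unit_disc" for z
    using holomorphic_injective_imp_regular[OF hol _ inj that] by simp
  have eq: "v z / deriv \<phi> z = u z / (z * deriv \<phi> z)" if "z \<in> unit_disc" "z \<noteq> 0" for z
    using that v(2)[of z] by simp
  have "Re (v \<zeta> / deriv \<phi> \<zeta>) < 0"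
  proof (rule Re_neg_of_nonpos[where H = "\<lambda>z. v z / deriv \<phi> z"])
    show "Re (v z / deriv \<phi> z) \<le> 0" if "z \<in> unit_disc" for z
      using univalent_variation[OF hol inj u sub that] eq[OF that] neg v(3) by (cases "z = 0") auto
  qed (use nz neg v \<zeta> in \<open>auto intro!: holomorphic_intros hol\<close>)
  then show ?thesis
    using eq[OF \<zeta>] by simp
qed

text \<open>The variation is the chord from \<open>\<phi> w\<close> to \<open>\<phi> (a * w)\<close>
  with a = z / \<zeta>, which stays in the convex image. At 0 its quotient is a - 1, with negative
  real part because |a| <= 1 and a \<noteq> 1.\<close>

lemma convex_function_support:
  assumes \<phi>: "convex_function \<phi>" and z: "norm z \<le> norm \<zeta>" "z \<noteq> \<zeta>" and \<zeta>: "\<zeta> \<in> unit_disc"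
  shows "Re ((\<phi> z - \<phi> \<zeta>) / (\<zeta> * deriv \<phi> \<zeta>)) < 0"
proof -
  define a where "a = z / \<zeta>"
  have \<zeta>0: "\<zeta> \<noteq> 0" using z by auto
  have hol: "\<phi> holomorphic_on unit_disc" and inj: "inj_on \<phi> unit_disc" and cv: "convex (\<phi> ` unit_disc)"
    using \<phi> by (auto simp: convex_function_def)
  have a: "norm a \<le> 1" "a \<noteq> 1" "a * \<zeta> = z"
    using z \<zeta>0 by (auto simp: a_def norm_divide)
  have aD: "a * w \<in> unit_disc" if "w \<in> unit_disc" for w
    using that a(1) mult_left_le_one_le[of "norm w" "norm a"] by (auto simp: norm_mult)
  have hola: "(\<lambda>w. \<phi> (a * w)) holomorphic_on unit_disc"
    using holomorphic_on_compose_gen[OF _ hol, of "\<lambda>w. a * w" unit_disc] aD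
    by (force simp: o_def intro!: holomorphic_intros)
  have nz: "deriv \<phi> 0 \<noteq> 0"
    using holomorphic_injective_imp_regular[OF hol _ inj, of 0] by simp
  have "(\<phi> has_field_derivative deriv \<phi> 0) (at (a * 0))"
    using holomorphic_derivI[OF hol, of 0] by simp
  then have "((\<lambda>w. \<phi> (a * w) - \<phi> w) has_field_derivative deriv \<phi> 0 * a - deriv \<phi> 0) (at 0)"
    using holomorphic_derivI[OF hol, of 0]
    by (intro DERIV_diff DERIV_chain2[of \<phi>]) (auto intro!: derivative_eq_intros)
  then have du: "deriv (\<lambda>w. \<phi> (a * w) - \<phi> w) 0 = deriv \<phi> 0 * (a - 1)"
    by (simp add: DERIV_imp_deriv algebra_simps)
  have "Re a < 1"
  proof (rule ccontr)
    assume "\<not> Re a < 1"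
    then have "Re a = 1" using a(1) complex_Re_le_cmod[of a] by linarith
    moreover have "Im a = 0"
      using a(1) \<open>Re a = 1\<close> by (simp add: cmod_def)
    ultimately show False using a(2) by (simp add: complex_eq_iff)
  qed
  have "Re ((\<phi> (a * \<zeta>) - \<phi> \<zeta>) / (\<zeta> * deriv \<phi> \<zeta>)) < 0"
  proof (rule univalent_variation_strict[OF hol inj, where u = "\<lambda>w. \<phi> (a * w) - \<phi> w"])
    show "\<phi> w + of_real t * (\<phi> (a * w) - \<phi> w) \<in> \<phi> ` unit_disc"
      if "w \<in> unit_disc" "0 \<le> t" "t \<le> 1" for w t
    proof -
      have "(1 - t) *\<^sub>R \<phi> w + t *\<^sub>R \<phi> (a * w) \<in> \<phi> ` unit_disc"
        using that aD by (intro convexD[OF cv]) auto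
      then show ?thesis by (simp add: scaleR_conv_of_real algebra_simps)
    qed
    show "Re (deriv (\<lambda>w. \<phi> (a * w) - \<phi> w) 0 / deriv \<phi> 0) < 0"
      using nz \<open>Re a < 1\<close> by (simp add: du)
  qed (use \<zeta>0 \<zeta> in \<open>auto intro!: holomorphic_intros hola hol\<close>)
  then show ?thesis by (simp add: a(3))
qed

text \<open>Here the variation runs along the segment towards the centre \<open>a\<close>; its
  quotient at 0 is -1.\<close>

lemma starlike_function_Re_pos:
  assumes \<psi>: "starlike_function_wrt a \<psi>" "\<psi> 0 = a" and \<zeta>: "\<zeta> \<in> unit_disc" "\<zeta> \<noteq> 0"
  shows "Re ((\<psi> \<zeta> - a) / (\<zeta> * deriv \<psi> \<zeta>)) > 0"
proof -
  have hol: "\<psi> holomorphic_on unit_disc" and inj: "inj_on \<psi> unit_disc"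
    and seg: "\<And>z. z \<in> unit_disc \<Longrightarrow> closed_segment a (\<psi> z) \<subseteq> \<psi> ` unit_disc"
    using \<psi> by (auto simp: starlike_function_wrt_def)
  have nz: "deriv \<psi> 0 \<noteq> 0"
    using holomorphic_injective_imp_regular[OF hol _ inj, of 0] by simp
  have "((\<lambda>w. a - \<psi> w) has_field_derivative - deriv \<psi> 0) (at 0)"
    using holomorphic_derivI[OF hol, of 0] by (auto intro!: derivative_eq_intros)
  then have du: "deriv (\<lambda>w. a - \<psi> w) 0 = - deriv \<psi> 0"
    by (simp add: DERIV_imp_deriv)
  have "Re ((a - \<psi> \<zeta>) / (\<zeta> * deriv \<psi> \<zeta>)) < 0"
  proof (rule univalent_variation_strict[OF hol inj, where u = "\<lambda>w. a - \<psi> w"])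
    show "\<psi> w + of_real t * (a - \<psi> w) \<in> \<psi> ` unit_disc"
      if "w \<in> unit_disc" "0 \<le> t" "t \<le> 1" for w t
    proof -
      have "\<psi> w + of_real t * (a - \<psi> w) = (1 - (1 - t)) *\<^sub>R a + (1 - t) *\<^sub>R \<psi> w"
        by (simp add: scaleR_conv_of_real algebra_simps)
      then have "\<psi> w + of_real t * (a - \<psi> w) \<in> closed_segment a (\<psi> w)"
        using that unfolding in_segment by (intro exI[of _ "1 - t"]) auto
      then show ?thesis using seg that by blast
    qed
  qed (use \<zeta> \<psi> du nz in \<open>auto intro!: holomorphic_intros hol\<close>)
  then show ?thesis
    by (metis minus_diff_eq minus_divide_left neg_0_less_iff_less neg_less_0_iff_less uminus_complex.simps(1))
qed

section \<open>Briot--Bouquet subordination\<close>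

text \<open>Jack's lemma: at a point of maximal modulus the logarithmic derivative is real and at
  least the growth exponent given by the Schwarz lemma.\<close>

lemma Jack:
  fixes w :: "complex \<Rightarrow> complex"
  assumes w: "(w has_field_derivative w') (at z0)" and z0: "z0 \<noteq> 0" and nz: "w z0 \<noteq> 0"
    and le: "\<And>z. norm z \<le> norm z0 \<Longrightarrow> norm (w z) * norm z0 \<le> norm z * norm (w z0)"
  obtains m :: real where "m \<ge> 1" "z0 * w' = of_real m * w z0"
proof -
  define k where "k = z0 * w' / w z0"
  \<comment> \<open>For Re d < 0 the point z0 (1 + t d) moves into the disc. Dividing
    \<open>w\<close> by 1 + t d turns the growth hypothesis into |q t| <= |q 0|, and d (k - 1) is
    the logarithmic derivative of \<open>q\<close> at 0. Letting d range over the left half-plane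
    forces k - 1 to be real and nonnegative.\<close>
  have dir: "Re (d * (k - 1)) \<le> 0" if d: "Re d < 0" for d
  proof -
    define q where "q = (\<lambda>t::real. w (z0 + of_real t * (z0 * d)) / (1 + of_real t * d))"
    have "((\<lambda>t. z0 + of_real t * (z0 * d)) has_vector_derivative z0 * d) (at 0)"
      by (auto intro!: derivative_eq_intros simp: scaleR_conv_of_real)
    moreover have "(w has_field_derivative w') (at (z0 + of_real 0 * (z0 * d)))"
      using w by simp
    ultimately have 1: "((\<lambda>t. w (z0 + of_real t * (z0 * d))) has_vector_derivative z0 * d * w') (at 0)"
      using field_vector_diff_chain_at[of "\<lambda>t::real. z0 + of_real t * (z0 * d)" "z0 * d" 0 w w']
      by (simp add: o_def)
    have "((\<lambda>t. 1 / (1 + t * d)) has_field_derivative - d) (at (of_real 0))"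
      by (auto intro!: derivative_eq_intros)
    from has_vector_derivative_real_field[OF this]
    have 2: "((\<lambda>t::real. 1 / (1 + of_real t * d)) has_vector_derivative - d) (at 0)" .
    have "(q has_vector_derivative w z0 * (- d) + z0 * d * w') (at 0)"
      using has_vector_derivative_mult[OF 1 2] by (simp add: q_def)
    then have "(q has_vector_derivative w z0 * (d * (k - 1))) (at 0)"
      using nz by (simp add: k_def algebra_simps)
    \<comment> \<open>The upper end of the range of \<open>t\<close> is where 1 + t d meets the unit
      circle again.\<close>
    moreover have "norm (q t) \<le> norm (q 0)" if t: "0 \<le> t" "t < - 2 * Re d / (norm d)\<^sup>2" for t
    proof -
      have eq: "z0 + of_real t * (z0 * d) = z0 * (1 + of_real t * d)" by (simp add: algebra_simps)
      have "(norm (1 + of_real t * d))\<^sup>2 = 1 + t * (2 * Re d + t * (norm d)\<^sup>2)"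
        by (simp add: cmod_power2) (simp add: power2_eq_square algebra_simps)
      also have "\<dots> \<le> 1"
      proof -
        have "2 * Re d + t * (norm d)\<^sup>2 \<le> 0"
          using t d by (cases "d = 0") (auto simp: field_simps)
        then show ?thesis using t by (simp add: mult_le_0_iff)
      qed
      finally have le1: "norm (1 + of_real t * d) \<le> 1"
        by (simp add: power_le_one_iff)
      show ?thesis
      proof (cases "1 + of_real t * d = 0")
        case False
        have "norm (w (z0 * (1 + of_real t * d))) * norm z0 \<le> norm z0 * norm (1 + of_real t * d) * norm (w z0)"
          using le[of "z0 * (1 + of_real t * d)"] le1 mult_left_le[OF le1, of "norm z0"] by (simp add: norm_mult)
        then have "norm (w (z0 * (1 + of_real t * d))) \<le> norm (1 + of_real t * d) * norm (w z0)"
          using z0 by simp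
        then show ?thesis
          using False unfolding q_def eq by (simp add: norm_divide divide_le_eq mult.commute)
      \<comment> \<open>When the denominator vanishes, division by zero gives
        \<open>q t = 0\<close>, and the bound is trivial.\<close>
      qed (simp add: q_def)
    qed
    moreover have "- 2 * Re d / (norm d)\<^sup>2 > 0"
      using d by (intro divide_pos_pos) auto
    ultimately have "Re (cnj (q 0) * (w z0 * (d * (k - 1)))) \<le> 0"
      by (intro norm_le_imp_Re_deriv_nonpos) auto
    moreover have "cnj (q 0) * (w z0 * (d * (k - 1))) = of_real ((norm (w z0))\<^sup>2) * (d * (k - 1))"
      by (simp add: q_def complex_norm_square del: of_real_power)
    ultimately have "(norm (w z0))\<^sup>2 * Re (d * (k - 1)) \<le> 0"
      by (simp only: Re_of_real_mult)
    then show ?thesis using nz by (simp add: mult_le_0_iff)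
  qed
  have "Re k \<ge> 1"
    using dir[of "-1"] by simp
  moreover have "Im k = 0"
  proof (rule ccontr)
    assume "Im k \<noteq> 0"
    \<comment> \<open>The directions -e + i and -e - i give |Im k| <= e (Re k - 1); this
      \<open>e\<close> makes the right side less than |Im k|.\<close>
    define e where "e = \<bar>Im k\<bar> / (2 * Re k)"
    have "e > 0" using \<open>Im k \<noteq> 0\<close> \<open>Re k \<ge> 1\<close> by (simp add: e_def)
    have "e * (Re k - 1) < \<bar>Im k\<bar>"
      using \<open>Re k \<ge> 1\<close> \<open>Im k \<noteq> 0\<close> by (simp add: e_def field_simps) (smt (verit, best) mult_pos_pos mult_nonneg_nonneg zero_less_abs_iff)
    moreover have "\<bar>Im k\<bar> \<le> e * (Re k - 1)"
      using dir[of "Complex (- e) 1"] dir[of "Complex (- e) (-1)"] \<open>e > 0\<close> by (auto simp: abs_if)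
    ultimately show False by simp
  qed
  ultimately have "z0 * w' = of_real (Re k) * w z0"
    using nz by (simp add: k_def complex_is_Real_iff complex_eq_iff[of _ "of_real _"] field_simps)
  with \<open>Re k \<ge> 1\<close> show ?thesis using that by blast
qed

lemma Schwarz_rescaled:
  assumes f: "f holomorphic_on ball 0 r" "f 0 = 0" and lt: "\<And>z. norm z < r \<Longrightarrow> norm (f z) < R"
    and z: "norm z < r"
  shows "norm (f z) * r \<le> norm z * R"
proof -
  have r: "r > 0" using z by (meson norm_ge_zero le_less_trans)
  have R: "R > 0" using lt[OF z] by (meson norm_ge_zero le_less_trans)
  have "norm (f (of_real r * (z / of_real r)) / of_real R) \<le> norm (z / of_real r)"
  proof (rule Schwarz_Lemma(1)[where f = "\<lambda>z. f (of_real r * z) / of_real R"])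
    have "(f \<circ> (\<lambda>z. of_real r * z)) holomorphic_on ball 0 1"
      using r by (intro holomorphic_on_compose_gen[OF _ f(1)] holomorphic_intros) (auto simp: norm_mult)
    then show "(\<lambda>z. f (of_real r * z) / of_real R) holomorphic_on ball 0 1"
      using R by (auto intro!: holomorphic_intros simp: o_def)
    show "norm (f (of_real r * z) / of_real R) < 1" if "norm z < 1" for z
      using lt[of "of_real r * z"] that r R by (simp add: norm_mult norm_divide)
  qed (use f z r in \<open>auto simp: norm_divide\<close>)
  then show ?thesis using r R by (simp add: norm_divide field_simps)
qed

text \<open>If \<open>p\<close> is not subordinate to \<open>q\<close>, blow up discs until \<open>p\<close> first touches the boundary of the
  image under \<open>q\<close> of a larger disc, and apply Jack's lemma to \<open>q\<inverse> \<circ> p\<close> there.\<close>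

lemma subordinateI_contact:
  assumes p: "p holomorphic_on unit_disc" and q: "q holomorphic_on unit_disc" "inj_on q unit_disc"
    and 0: "p 0 = q 0"
    and contact: "\<And>z \<zeta> m. \<lbrakk>z \<noteq> 0; norm z < norm \<zeta>; norm \<zeta> < 1; 1 \<le> m; p z = q \<zeta>;
           z * deriv p z = of_real m * (\<zeta> * deriv q \<zeta>)\<rbrakk> \<Longrightarrow> False"
  shows "subordinate p q"
proof -
  obtain h where h: "h holomorphic_on q ` unit_disc"
      "\<And>z. z \<in> unit_disc \<Longrightarrow> deriv q z * deriv h (q z) = 1"
      "\<And>z. z \<in> unit_disc \<Longrightarrow> h (q z) = z"
    using holomorphic_has_inverse[OF q(1) _ q(2)] by auto
  have opq: "open (q ` ball 0 \<rho>)" if "\<rho> \<le> 1" for \<rho>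
    using that by (intro open_mapping_thm3 holomorphic_on_subset[OF q(1)] inj_on_subset[OF q(2)]) auto
  have contp: "continuous_on A p" and contq: "continuous_on A q" if "A \<subseteq> unit_disc" for A
    using that p q holomorphic_on_imp_continuous_on continuous_on_subset by blast+
  \<comment> \<open>Working with \<rho> < 1 keeps the contact point \<zeta>, of modulus \<rho>,
    inside the domain of \<open>q\<close>. It also yields the strict inequality |z| < |\<zeta>| that
    \<open>contact\<close> offers to its users.\<close>
  have key: "p z \<in> q ` ball 0 \<rho>" if \<rho>: "\<rho> < 1" and z: "norm z < \<rho>" for z \<rho>
  proof (rule ccontr)
    assume bad: "p z \<notin> q ` ball 0 \<rho>"
    define K where "K = {x \<in> cball 0 (norm z). p x \<in> - (q ` ball 0 \<rho>)}"
    have "closed (cball 0 (norm z) \<inter> p -` (- (q ` ball 0 \<rho>)))"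
      using \<rho> z by (intro continuous_closed_preimage contp) (auto simp: closed_def intro!: opq)
    then have "compact K"
      unfolding K_def compact_eq_bounded_closed
      by (auto intro: bounded_subset[OF bounded_cball[of 0 "norm z"]] simp: vimage_def Int_def)
    moreover have "z \<in> K" using bad by (auto simp: K_def)
    ultimately obtain z0 where z0: "z0 \<in> K" "\<And>x. x \<in> K \<Longrightarrow> norm z0 \<le> norm x"
      using continuous_attains_inf[of K norm] by (auto intro: continuous_on_norm_id)
    have z0z: "norm z0 \<le> norm z" and z0bad: "p z0 \<notin> q ` ball 0 \<rho>"
      using z0(1) by (auto simp: K_def)
    have small: "p x \<in> q ` ball 0 \<rho>" if "norm x < norm z0" for x
    proof (rule ccontr)
      assume "p x \<notin> q ` ball 0 \<rho>"
      then have "x \<in> K" using that z0z by (auto simp: K_def)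
      then show False using z0(2)[of x] that by simp
    qed
    have \<rho>0: "\<rho> > 0" using z by (meson norm_ge_zero le_less_trans)
    have z0nz: "z0 \<noteq> 0"
      using z0bad 0 \<rho>0 by auto
    \<comment> \<open>The image of the closed disc under \<open>q\<close> is compact, so values of
      \<open>p\<close> on the circle through \<open>z0\<close> are still attained by
      \<open>q\<close> with modulus at most \<rho>.\<close>
    have cl: "p x \<in> q ` cball 0 \<rho>" if "norm x \<le> norm z0" for x
    proof -
      have "compact (q ` cball 0 \<rho>)"
        using \<rho> by (intro compact_continuous_image contq) auto
      then have "closed (q ` cball 0 \<rho>)" by (rule compact_imp_closed)
      moreover have "p ` closure (ball 0 (norm z0)) \<subseteq> closure (q ` cball 0 \<rho>)"
      proof (rule image_closure_subset)
        show "continuous_on (closure (ball 0 (norm z0))) p"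
          using z0z z \<rho> z0nz by (intro contp) auto
        show "p ` ball 0 (norm z0) \<subseteq> closure (q ` cball 0 \<rho>)"
          using small closure_subset ball_subset_cball by fastforce
      qed simp
      moreover have "x \<in> closure (ball 0 (norm z0))"
        using z0nz that by simp
      ultimately show ?thesis by auto
    qed
    from cl[of z0] obtain \<zeta> where \<zeta>: "norm \<zeta> \<le> \<rho>" "p z0 = q \<zeta>" by auto
    with z0bad have \<zeta>\<rho>: "norm \<zeta> = \<rho>" by fastforce
    define w where "w = (\<lambda>x. h (p x))"
    have wz0: "w z0 = \<zeta>"
      using \<zeta> \<rho> h(3)[of \<zeta>] by (simp add: w_def)
    have w_small: "norm (w x) < \<rho>" if x: "norm x < norm z0" for x
    proof -
      obtain y where "norm y < \<rho>" "p x = q y" using small[OF x] by auto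
      then show ?thesis using h(3)[of y] \<rho> by (simp add: w_def)
    qed
    have holw: "w holomorphic_on ball 0 (norm z0)"
    proof -
      have "(h \<circ> p) holomorphic_on ball 0 (norm z0)"
      proof (rule holomorphic_on_compose_gen[OF _ h(1)])
        show "p holomorphic_on ball 0 (norm z0)"
          using z0z z \<rho> by (intro holomorphic_on_subset[OF p]) auto
        show "p ` ball 0 (norm z0) \<subseteq> q ` unit_disc"
          using small \<rho> by fastforce
      qed
      then show ?thesis by (simp add: w_def o_def)
    qed
    have dp: "(p has_field_derivative deriv p z0) (at z0)"
      using p z0z z \<rho> by (auto intro!: holomorphic_derivI)
    have dh: "(h has_field_derivative deriv h (q \<zeta>)) (at (p z0))"
      using h(1) opq[of 1] \<zeta> \<rho> by (auto intro!: holomorphic_derivI)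
    have dw: "(w has_field_derivative deriv h (q \<zeta>) * deriv p z0) (at z0)"
      unfolding w_def using DERIV_chain2[OF dh dp] .
    obtain m where m: "m \<ge> 1" "z0 * (deriv h (q \<zeta>) * deriv p z0) = of_real m * w z0"
    proof (rule Jack[OF dw z0nz])
      show "w z0 \<noteq> 0" using wz0 \<zeta>\<rho> \<rho>0 by auto
      \<comment> \<open>Inside the circle this is the Schwarz lemma. On the circle itself
        \<open>w\<close> need not be holomorphic, but the bound \<rho> suffices.\<close>
      show "norm (w x) * norm z0 \<le> norm x * norm (w z0)" if x: "norm x \<le> norm z0" for x
      proof (cases "norm x < norm z0")
        case True
        have "w 0 = 0" using 0 h(3)[of 0] by (simp add: w_def)
        then show ?thesis
          using Schwarz_rescaled[OF holw _ w_small True] wz0 \<zeta>\<rho> by simp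
      next
        case False
        then have nx: "norm x = norm z0" using x by simp
        from cl[OF x] obtain y where "norm y \<le> \<rho>" "p x = q y" by auto
        then have "norm (w x) \<le> \<rho>" using h(3)[of y] \<rho> by (simp add: w_def)
        then show ?thesis using nx wz0 \<zeta>\<rho> by (simp add: mult.commute[of _ "norm z0"] mult_left_mono)
      qed
    qed
    have "z0 * deriv p z0 = of_real m * (\<zeta> * deriv q \<zeta>)"
    proof -
      have "deriv q \<zeta> * deriv h (q \<zeta>) = 1" using h(2)[of \<zeta>] \<zeta> \<rho> by simp
      then have "z0 * deriv p z0 = deriv q \<zeta> * deriv h (q \<zeta>) * (z0 * deriv p z0)"
        by simp
      also have "\<dots> = deriv q \<zeta> * (z0 * (deriv h (q \<zeta>) * deriv p z0))"
        by (simp add: algebra_simps)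
      also have "\<dots> = deriv q \<zeta> * (of_real m * \<zeta>)"
        by (simp only: m(2) wz0)
      finally show ?thesis by (simp add: mult_ac)
    qed
    then show False
      using contact[OF z0nz _ _ m(1) \<zeta>(2)] z0z z \<rho> \<zeta>\<rho> by auto
  qed
  have sub: "p z \<in> q ` unit_disc" if "z \<in> unit_disc" for z
  proof -
    obtain \<rho> where "norm z < \<rho>" "\<rho> < 1" using \<open>z \<in> unit_disc\<close> dense[of "norm z" 1] by auto
    then show ?thesis using key[of \<rho> z] by fastforce
  qed
  then show ?thesis
    by (rule subordinateI_univalent[OF p q 0])
qed

text \<open>At a contact point, \<open>\<phi> (w z) - \<phi> \<zeta>\<close> is m / \<phi> \<zeta>
  times the outer normal. As Re \<phi> > 0 this points outward, which the support inequality
  forbids. The lemma serves for \<psi> as well as for the positivity of Re p needed to exclude zeros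
  of f(z) / z.\<close>

lemma briot_bouquet_subordinate:
  assumes \<phi>: "convex_function \<phi>" "\<And>z. z \<in> unit_disc \<Longrightarrow> Re (\<phi> z) > 0"
    and p: "p holomorphic_on unit_disc" "p 0 = \<phi> 0"
    and sub: "subordinate (\<lambda>z. p z + z * deriv p z / p z) \<phi>"
  shows "subordinate p \<phi>"
proof -
  have hol: "\<phi> holomorphic_on unit_disc" and inj: "inj_on \<phi> unit_disc"
    using \<phi> by (auto simp: convex_function_def)
  obtain w where w: "\<And>z. z \<in> unit_disc \<Longrightarrow> norm (w z) \<le> norm z"
    "\<And>z. z \<in> unit_disc \<Longrightarrow> p z + z * deriv p z / p z = \<phi> (w z)"
    using subordinateE[OF sub] by metis
  show ?thesis
  proof (rule subordinateI_contact[OF p(1) hol inj p(2)])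
    fix z \<zeta> and m :: real
    assume z: "z \<noteq> 0" "norm z < norm \<zeta>" "norm \<zeta> < 1" "1 \<le> m" "p z = \<phi> \<zeta>"
       "z * deriv p z = of_real m * (\<zeta> * deriv \<phi> \<zeta>)"
    have nz: "deriv \<phi> \<zeta> \<noteq> 0" "\<zeta> \<noteq> 0"
      using holomorphic_injective_imp_regular[OF hol _ inj, of \<zeta>] z by auto
    have "\<phi> (w z) = \<phi> \<zeta> + of_real m * (\<zeta> * deriv \<phi> \<zeta>) / \<phi> \<zeta>"
      using w(2)[of z] z by auto
    then have "(\<phi> (w z) - \<phi> \<zeta>) / (\<zeta> * deriv \<phi> \<zeta>) = of_real m * (1 / \<phi> \<zeta>)"
      using nz by (simp add: field_simps)
    moreover have "Re ((\<phi> (w z) - \<phi> \<zeta>) / (\<zeta> * deriv \<phi> \<zeta>)) < 0"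
      using w(1)[of z] z by (intro convex_function_support[OF \<phi>(1)]) auto
    moreover have "Re (of_real m * (1 / \<phi> \<zeta>)) > 0"
      using z \<phi>(2)[of \<zeta>] by (simp add: Re_divide sum_power2_gt_zero_iff)
    ultimately show False by simp
  qed
qed

text \<open>Substituting the equation of \<psi> at a contact point gives
  \<open>\<phi> (w z) - \<phi> \<zeta>\<close> = (m - 1) (\<phi> \<zeta> - \<psi> \<zeta>). The left
  side points strictly inward at \<phi> \<zeta>, the right side does not. Univalence of \<psi> is
  what the convex and the starlike case share, so both can use this.\<close>

lemma briot_bouquet_best_dominant:
  assumes \<phi>: "convex_function \<phi>" "\<And>z. z \<in> unit_disc \<Longrightarrow> Re (\<phi> z) > 0" "\<phi> 0 = 1"
    and \<psi>: "briot_bouquet_solution \<phi> \<psi>" "inj_on \<psi> unit_disc"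
    and p: "p holomorphic_on unit_disc" "p 0 = 1"
    and sub: "subordinate (\<lambda>z. p z + z * deriv p z / p z) \<phi>"
  shows "subordinate p \<psi>"
proof -
  have hol: "\<phi> holomorphic_on unit_disc" and inj: "inj_on \<phi> unit_disc"
    using \<phi> by (auto simp: convex_function_def)
  have hol\<psi>: "\<psi> holomorphic_on unit_disc" and \<psi>0: "\<psi> 0 = 1"
    and eq: "\<And>z. z \<in> unit_disc \<Longrightarrow> \<psi> z + z * deriv \<psi> z / \<psi> z = \<phi> z"
    using \<psi> by (auto simp: briot_bouquet_solution_def)
  \<comment> \<open>This locates \<psi> \<zeta> as a value of \<phi> at a point of modulus at most
    |\<zeta>|, hence on the inner side of the support line at \<phi> \<zeta>.\<close>
  have "subordinate \<psi> \<phi>"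
  proof (rule briot_bouquet_subordinate[OF \<phi>(1,2) hol\<psi>])
    show "subordinate (\<lambda>z. \<psi> z + z * deriv \<psi> z / \<psi> z) \<phi>"
      unfolding subordinate_def using eq by (intro exI[of _ "\<lambda>z. z"]) auto
  qed (use \<phi> \<psi>0 in auto)
  then obtain v where v: "\<And>z. z \<in> unit_disc \<Longrightarrow> norm (v z) \<le> norm z"
    "\<And>z. z \<in> unit_disc \<Longrightarrow> \<psi> z = \<phi> (v z)"
    using subordinateE by metis
  obtain w where w: "\<And>z. z \<in> unit_disc \<Longrightarrow> norm (w z) \<le> norm z"
    "\<And>z. z \<in> unit_disc \<Longrightarrow> p z + z * deriv p z / p z = \<phi> (w z)"
    using subordinateE[OF sub] by metis
  show ?thesis
  proof (rule subordinateI_contact[OF p(1) hol\<psi> \<psi>(2)])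
    fix z \<zeta> and m :: real
    assume z: "z \<noteq> 0" "norm z < norm \<zeta>" "norm \<zeta> < 1" "1 \<le> m" "p z = \<psi> \<zeta>"
       "z * deriv p z = of_real m * (\<zeta> * deriv \<psi> \<zeta>)"
    let ?N = "\<zeta> * deriv \<phi> \<zeta>"
    have "\<phi> (w z) = \<psi> \<zeta> + of_real m * (\<zeta> * deriv \<psi> \<zeta> / \<psi> \<zeta>)"
      using w(2)[of z] z by auto
    also have "\<zeta> * deriv \<psi> \<zeta> / \<psi> \<zeta> = \<phi> \<zeta> - \<psi> \<zeta>"
      using eq[of \<zeta>] z by (simp add: algebra_simps)
    finally have "(\<phi> (w z) - \<phi> \<zeta>) / ?N = - (of_real (m - 1) * ((\<psi> \<zeta> - \<phi> \<zeta>) / ?N))"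
      by (simp add: divide_simps) (simp add: algebra_simps)
    moreover have "Re ((\<psi> \<zeta> - \<phi> \<zeta>) / ?N) \<le> 0"
      using v[of \<zeta>] z convex_function_support[OF \<phi>(1), of "v \<zeta>" \<zeta>]
      by (cases "v \<zeta> = \<zeta>") auto
    moreover have "Re ((\<phi> (w z) - \<phi> \<zeta>) / ?N) < 0"
      using w(1)[of z] z by (intro convex_function_support[OF \<phi>(1)]) auto
    ultimately show False
      using z(4) mult_nonneg_nonpos[of "m - 1" "Re ((\<psi> \<zeta> - \<phi> \<zeta>) / ?N)"]
      by (simp only: Re_of_real_mult uminus_complex.simps) simp
  qed (use p \<psi>0 in auto)
qed

section \<open>Logarithmic derivatives\<close>

text \<open>Let \<open>z0\<close> be a zero of \<open>g\<close> of least modulus r. On the open disc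
  of radius r the quotient p = f' / g is holomorphic and, rescaled, subordinate to \<phi>; so Re p >
  0 there and |f| cannot decrease to 0 on the way to \<open>z0\<close>. The identity assumes
  \<open>g z \<noteq> 0\<close> pointwise because it is used before zeros are excluded.\<close>

lemma convex_class_zero_free:
  assumes \<phi>: "convex_function \<phi>" "\<And>z. z \<in> unit_disc \<Longrightarrow> Re (\<phi> z) > 0" "\<phi> 0 = 1"
    and f: "f \<in> class_C \<phi>"
    and g: "g holomorphic_on unit_disc" "\<And>z. z \<in> unit_disc \<Longrightarrow> f z = z * g z"
  shows "\<And>z. z \<in> unit_disc \<Longrightarrow> g z \<noteq> 0"
    and "\<And>z. \<lbrakk>z \<in> unit_disc; g z \<noteq> 0\<rbrakk> \<Longrightarrow>
          deriv f z / g z + z * deriv (\<lambda>z. deriv f z / g z) z / (deriv f z / g z)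
            = 1 + z * deriv (deriv f) z / deriv f z"
proof -
  have holf: "f holomorphic_on unit_disc" and f'0: "deriv f 0 = 1"
    and f'nz: "\<And>z. z \<in> unit_disc \<Longrightarrow> deriv f z \<noteq> 0"
    and sub: "subordinate (\<lambda>z. 1 + z * deriv (deriv f) z / deriv f z) \<phi>"
    using f by (auto simp: class_C_def normalized_analytic_def)
  obtain w where w: "w holomorphic_on unit_disc" "\<And>z. z \<in> unit_disc \<Longrightarrow> norm (w z) \<le> norm z"
    "\<And>z. z \<in> unit_disc \<Longrightarrow> 1 + z * deriv (deriv f) z / deriv f z = \<phi> (w z)"
    using subordinateE[OF sub] by metis
  have holf': "deriv f holomorphic_on unit_disc"
    using holf by (auto intro: holomorphic_deriv)
  have df: "deriv f z = g z + z * deriv g z" if "z \<in> unit_disc" for z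
  proof -
    have "((\<lambda>z. z * g z) has_field_derivative g z + z * deriv g z) (at z)"
      using holomorphic_derivI[OF g(1) _ that] by (auto intro!: derivative_eq_intros)
    then have "(f has_field_derivative g z + z * deriv g z) (at z)"
      by (rule has_field_derivative_transform_within_open[OF _ open_ball that]) (use g in auto)
    then show ?thesis by (rule DERIV_imp_deriv)
  qed
  have g0: "g 0 = 1" using df[of 0] f'0 by simp
  define p where "p = (\<lambda>z. deriv f z / g z)"
  have dp: "(p has_field_derivative (deriv (deriv f) z * g z - deriv f z * deriv g z) / (g z)\<^sup>2) (at z)"
    if "z \<in> unit_disc" "g z \<noteq> 0" for z
    unfolding p_def using holomorphic_derivI[OF g(1) _ that(1)] holomorphic_derivI[OF holf' _ that(1)] that(2)
    by (auto intro!: derivative_eq_intros simp: power2_eq_square)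
  show ode: "p z + z * deriv p z / p z = 1 + z * deriv (deriv f) z / deriv f z"
    if "z \<in> unit_disc" "g z \<noteq> 0" for z
  proof -
    have "z * deriv p z / p z = z * deriv (deriv f) z / deriv f z - z * deriv g z / g z"
      using that f'nz[OF that(1)] unfolding DERIV_imp_deriv[OF dp[OF that]]
      by (simp add: p_def field_simps power2_eq_square)
    moreover have "p z = 1 + z * deriv g z / g z"
      using that by (simp add: p_def df field_simps)
    ultimately show ?thesis by simp
  qed
  show "g z \<noteq> 0" if z: "z \<in> unit_disc" for z
  proof
    assume gz: "g z = 0"
    define K where "K = {x \<in> cball 0 (norm z). g x \<in> {0}}"
    have "closed (cball 0 (norm z) \<inter> g -` {0})"
      using z by (intro continuous_closed_preimage)
        (auto intro!: continuous_on_subset[OF holomorphic_on_imp_continuous_on[OF g(1)]])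
    then have "compact K"
      unfolding K_def compact_eq_bounded_closed
      by (auto intro: bounded_subset[OF bounded_cball[of 0 "norm z"]] simp: vimage_def Int_def)
    moreover have "z \<in> K" using gz by (auto simp: K_def)
    ultimately obtain z0 where z0: "z0 \<in> K" "\<And>x. x \<in> K \<Longrightarrow> norm z0 \<le> norm x"
      using continuous_attains_inf[of K norm] by (auto intro: continuous_on_norm_id)
    define r where "r = norm z0"
    have z0z: "norm z0 \<le> norm z" "g z0 = 0"
      using z0(1) by (auto simp: K_def)
    have r1: "r < 1" using z0z z by (simp add: r_def)
    have gnz: "g x \<noteq> 0" if "norm x < r" for x
      using z0(2)[of x] that z0z by (auto simp: K_def r_def)
    have r0: "r > 0" using z0z g0 by (auto simp: r_def)
    have rD: "of_real r * x \<in> ball 0 r" if "x \<in> unit_disc" for x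
      using that r0 by (simp add: norm_mult)
    have holp: "p holomorphic_on ball 0 r"
      unfolding p_def using gnz r1
      by (intro holomorphic_intros holomorphic_on_subset[OF holf'] holomorphic_on_subset[OF g(1)]) auto
    \<comment> \<open>Rescaling to the unit disc makes \<open>briot_bouquet_subordinate\<close>
      applicable; the expression p + z p' / p is invariant under it.\<close>
    define P where "P = (\<lambda>x. p (of_real r * x))"
    have "(p \<circ> (\<lambda>x. of_real r * x)) holomorphic_on unit_disc"
      using rD by (intro holomorphic_on_compose_gen[OF _ holp] holomorphic_intros) auto
    then have holP: "P holomorphic_on unit_disc" by (simp add: P_def o_def)
    have "subordinate P \<phi>"
    proof (rule briot_bouquet_subordinate[OF \<phi>(1,2) holP])
      show "P 0 = \<phi> 0" using \<phi> f'0 g0 by (simp add: P_def p_def)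
      show "subordinate (\<lambda>x. P x + x * deriv P x / P x) \<phi>"
        unfolding subordinate_def
      proof (intro exI[of _ "\<lambda>x. w (of_real r * x)"] conjI ballI)
        have "(w \<circ> (\<lambda>x. of_real r * x)) holomorphic_on unit_disc"
          using rD r1 by (intro holomorphic_on_compose_gen[OF _ w(1)] holomorphic_intros) force
        then show "(\<lambda>x. w (of_real r * x)) holomorphic_on unit_disc" by (simp add: o_def)
        show "(\<lambda>x. w (of_real r * x)) ` unit_disc \<subseteq> unit_disc"
        proof clarify
          fix x :: complex assume "x \<in> unit_disc"
          then have "norm (of_real r * x) < r" using rD by auto
          then have "norm (w (of_real r * x)) < r" using w(2)[of "of_real r * x"] r1 by simp
          then show "w (of_real r * x) \<in> unit_disc" using r1 by simp
        qed
        show "w (of_real r * 0) = 0" using w(2)[of 0] by simp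
        fix x :: complex assume x: "x \<in> unit_disc"
        define y where "y = of_real r * x"
        have y: "y \<in> unit_disc" "g y \<noteq> 0"
          using rD[OF x] r1 gnz[of y] by (auto simp: y_def)
        have "(P has_field_derivative deriv p y * of_real r) (at x)"
          unfolding P_def using holomorphic_derivI[OF holp, of y] rD[OF x]
          by (intro DERIV_chain2[of p]) (auto intro!: derivative_eq_intros simp: y_def)
        then have "deriv P x = deriv p y * of_real r" by (rule DERIV_imp_deriv)
        then have "P x + x * deriv P x / P x = p y + y * deriv p y / p y"
          by (simp add: P_def y_def mult_ac)
        then show "P x + x * deriv P x / P x = \<phi> (w (of_real r * x))"
          using ode[OF y] w(3)[OF y(1)] by (simp add: y_def)
      qed
    qed
    then have Pre: "Re (P x) > 0" if "x \<in> unit_disc" for x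
      using that \<phi>(2) by (force simp: subordinate_def)
    have pre: "Re (p x) > 0" if "norm x < r" for x
      using Pre[of "x / of_real r"] that r0 by (simp add: P_def norm_divide)
    text \<open>\<open>Re (z f'(z) / f(z)) > 0\<close> makes \<open>\<bar>f\<bar>\<close> increase along the radius towards \<open>z0\<close>.\<close>
    define F where "F = (\<lambda>t::real. f (of_real t * z0) \<bullet> f (of_real t * z0))"
    \<comment> \<open>The comparison starts at 1/2 because \<open>f\<close> vanishes at 0.\<close>
    have "F (1/2) \<le> F 1"
    proof (rule DERIV_nonneg_imp_nondecreasing[where f = F])
      fix t :: real assume t: "1/2 \<le> t" "t \<le> 1"
      define x where "x = of_real t * z0"
      have nx: "norm x = t * r" using t by (simp add: x_def norm_mult r_def)
      have xD: "x \<in> unit_disc" using nx t r1 r0 mult_left_le_one_le[of r t] unfolding mem_ball_0 by linarith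
      have "((\<lambda>t. f (of_real t * z0)) has_vector_derivative z0 * deriv f x) (at t)"
      proof -
        have "((\<lambda>t::real. of_real t * z0) has_vector_derivative z0) (at t)"
          by (auto intro!: derivative_eq_intros simp: scaleR_conv_of_real)
        from field_vector_diff_chain_at[OF this, of f "deriv f x"] show ?thesis
          using holomorphic_derivI[OF holf _ xD] by (simp add: o_def x_def)
      qed
      then have "(F has_real_derivative 2 * (f x \<bullet> (z0 * deriv f x))) (at t)"
        unfolding F_def x_def by (rule has_real_derivative_inner_self)
      moreover have "f x \<bullet> (z0 * deriv f x) \<ge> 0"
      proof (cases "t = 1")
        case True
        then have "f x = 0" using z0z g(2)[OF xD] by (simp add: x_def)
        then show ?thesis by simp
      next
        case False
        then have lt: "norm x < r" using nx t r0 by simp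
        have "f x \<bullet> (z0 * deriv f x) = Re (cnj (f x) * (z0 * deriv f x))"
          by (simp add: inner_complex_def)
        also have "cnj (f x) * (z0 * deriv f x) = of_real (t * (norm (z0 * g x))\<^sup>2) * p x"
          using gnz[OF lt] g(2)[OF xD]
          by (simp add: x_def p_def complex_norm_square field_simps del: of_real_power)
        also have "Re \<dots> = t * (norm (z0 * g x))\<^sup>2 * Re (p x)"
          by (rule Re_of_real_mult)
        also have "\<dots> \<ge> 0" using pre[OF lt] t by simp
        finally show ?thesis .
      qed
      ultimately show "\<exists>y. (F has_real_derivative y) (at t) \<and> 0 \<le> y"
        by (intro exI[of _ "2 * (f x \<bullet> (z0 * deriv f x))"]) simp
    qed simp
    moreover have "F 1 = 0"
      using z0z g(2)[of z0] r1 by (simp add: F_def r_def)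
    moreover have "f (of_real (1/2) * z0) \<noteq> 0"
      using gnz[of "of_real (1/2) * z0"] g(2)[of "of_real (1/2) * z0"] r0 r1
      by (auto simp: norm_mult r_def)
    then have "F (1/2) > 0" unfolding F_def by simp
    ultimately show False by simp
  qed
qed

lemma class_C_log_derivative:
  assumes \<phi>: "convex_function \<phi>" "\<And>z. z \<in> unit_disc \<Longrightarrow> Re (\<phi> z) > 0" "\<phi> 0 = 1"
    and f: "f \<in> class_C \<phi>"
  shows "\<exists>p L. p holomorphic_on unit_disc \<and> p 0 = 1 \<and>
    subordinate (\<lambda>z. p z + z * deriv p z / p z) \<phi> \<and>
    L holomorphic_on unit_disc \<and> L 0 = 0 \<and>
    (\<forall>z\<in>unit_disc. f z = z * exp (L z) \<and> p z = 1 + z * deriv L z)"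
proof -
  have holf: "f holomorphic_on unit_disc" and f0: "f 0 = 0" "deriv f 0 = 1"
    and sub: "subordinate (\<lambda>z. 1 + z * deriv (deriv f) z / deriv f z) \<phi>"
    using f by (auto simp: class_C_def normalized_analytic_def)
  obtain g where g: "g holomorphic_on unit_disc" "\<And>z. z \<in> unit_disc \<Longrightarrow> f z = z * g z" "g 0 = 1"
    using holomorphic_divide_at_zero[OF holf f0(1)] f0(2) by metis
  have gnz: "g z \<noteq> 0" if "z \<in> unit_disc" for z
    by (rule convex_class_zero_free(1)[OF \<phi> f g(1,2)]) (use that in auto)
  have ode: "deriv f z / g z + z * deriv (\<lambda>z. deriv f z / g z) z / (deriv f z / g z)
      = 1 + z * deriv (deriv f) z / deriv f z" if "z \<in> unit_disc" for z
    by (rule convex_class_zero_free(2)[OF \<phi> f g(1,2)]) (use that gnz in auto)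
  obtain h where h: "h holomorphic_on unit_disc" "\<And>z. z \<in> unit_disc \<Longrightarrow> exp (h z) = g z"
    using holomorphic_logarithm_exists[OF convex_ball open_ball g(1) gnz, where ?z0.0 = 0] by auto
  \<comment> \<open>Since exp (h 0) = g 0 = 1, subtracting \<open>h 0\<close> selects the branch
    vanishing at 0 and leaves the exponential unchanged.\<close>
  define L where "L = (\<lambda>z. h z - h 0)"
  have L: "L holomorphic_on unit_disc" "\<And>z. z \<in> unit_disc \<Longrightarrow> exp (L z) = g z"
    using h g(3) by (auto simp: L_def exp_diff intro!: holomorphic_intros)
  show ?thesis
  proof (rule exI[of _ "\<lambda>z. deriv f z / g z"], rule exI[of _ L], intro conjI ballI)
    show "(\<lambda>z. deriv f z / g z) holomorphic_on unit_disc"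
      using gnz g holf by (auto intro!: holomorphic_intros holomorphic_deriv)
    show "deriv f 0 / g 0 = 1" using f0 g by simp
    show "subordinate (\<lambda>z. deriv f z / g z + z * deriv (\<lambda>z. deriv f z / g z) z / (deriv f z / g z)) \<phi>"
      using sub ode by (simp add: subordinate_def)
    show "L 0 = 0" by (simp add: L_def)
    show "f z = z * exp (L z)" if "z \<in> unit_disc" for z using that L g by simp
    show "deriv f z / g z = 1 + z * deriv L z" if z: "z \<in> unit_disc" for z
    proof -
      have "((\<lambda>z. z * exp (L z)) has_field_derivative exp (L z) + z * (exp (L z) * deriv L z)) (at z)"
        using holomorphic_derivI[OF L(1) _ z] by (auto intro!: derivative_eq_intros)
      then have "(f has_field_derivative exp (L z) + z * (exp (L z) * deriv L z)) (at z)"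
        by (rule has_field_derivative_transform_within_open[OF _ open_ball z]) (use g L in auto)
      then have "deriv f z = g z * (1 + z * deriv L z)"
        using L(2)[OF z] by (simp add: DERIV_imp_deriv algebra_simps)
      then show ?thesis using gnz[OF z] by simp
    qed
  qed (rule L)
qed

lemma log_coeff_has_fps_expansion:
  assumes "L holomorphic_on unit_disc" "L 0 = 0"
    and "\<And>z. z \<in> unit_disc \<Longrightarrow> f z = z * exp (L z)"
  shows "L has_fps_expansion Abs_fps (\<lambda>m. 2 * log_coeff f m)"
  using log_coeff_sums[OF assms]
  by (intro has_fps_expansionI eventually_mono[OF eventually_nhds_in_open[of unit_disc]]) auto

lemma log_coeff_eq:
  assumes L: "L holomorphic_on unit_disc" "L 0 = 0"
    and f: "\<And>z. z \<in> unit_disc \<Longrightarrow> f z = z * exp (L z)"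
    and p: "\<And>z. z \<in> unit_disc \<Longrightarrow> p z = 1 + z * deriv L z" "p has_fps_expansion P"
    and m: "m \<ge> 1"
  shows "log_coeff f m = fps_nth P m / (2 * of_nat m)"
proof -
  define F where "F = Abs_fps (\<lambda>m. 2 * log_coeff f m)"
  have "L has_fps_expansion F"
    unfolding F_def by (rule log_coeff_has_fps_expansion[OF L f])
  then have "(\<lambda>z. 1 + z * deriv L z) has_fps_expansion 1 + fps_X * fps_deriv F"
    by (intro fps_expansion_intros)
  moreover have "p has_fps_expansion P \<longleftrightarrow> (\<lambda>z. 1 + z * deriv L z) has_fps_expansion P"
    by (rule has_fps_expansion_cong)
      (use p(1) in \<open>auto intro!: eventually_mono[OF eventually_nhds_in_open[of unit_disc]]\<close>)
  ultimately have "P = 1 + fps_X * fps_deriv F"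
    using p(2) fps_expansion_unique_complex by blast
  then have "fps_nth P m = of_nat m * (2 * log_coeff f m)"
    using m by (simp add: F_def)
  then show ?thesis using m by simp
qed

text \<open>Serves twice: the exponential of the primitive builds the candidate extremal function,
  and the primitive itself is the dominant of log (f(z) / z) in the starlike case.\<close>

lemma log_derivative_primitive:
  assumes "\<psi> holomorphic_on unit_disc" "\<psi> 0 = a"
  obtains G where "G holomorphic_on unit_disc" "G 0 = 0"
    "\<And>z. z \<in> unit_disc \<Longrightarrow> z * deriv G z = \<psi> z - a"
proof -
  obtain v where v: "v holomorphic_on unit_disc" "\<And>z. z \<in> unit_disc \<Longrightarrow> \<psi> z - a = z * v z"
    by (rule holomorphic_divide_at_zero[of "\<lambda>z. \<psi> z - a"]) (use assms in \<open>auto intro!: holomorphic_intros\<close>)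
  obtain L where L: "\<And>z. z \<in> unit_disc \<Longrightarrow> (L has_field_derivative v z) (at z within unit_disc)"
    using holomorphic_convex_primitive'[OF convex_ball open_ball v(1)] by metis
  have dL: "((\<lambda>z. L z - L 0) has_field_derivative v z) (at z)" if "z \<in> unit_disc" for z
    using L[OF that] that
    by (auto intro!: derivative_eq_intros simp: at_within_open[OF _ open_ball])
  show ?thesis
  proof
    show "(\<lambda>z. L z - L 0) holomorphic_on unit_disc"
      unfolding holomorphic_on_open[OF open_ball] using dL by blast
    show "z * deriv (\<lambda>z. L z - L 0) z = \<psi> z - a" if "z \<in> unit_disc" for z
      using v(2)[OF that] DERIV_imp_deriv[OF dL[OF that]] by simp
  qed simp
qed

text \<open>The function z exp (L z) has derivative exp (L z) (1 + z L'(z)) = exp (L z) \<psi>(z).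
  Existence keeps the sharpness claims from being vacuous.\<close>

lemma has_log_derivative_exists:
  assumes "\<psi> holomorphic_on unit_disc" "\<psi> 0 = 1"
  shows "\<exists>f. has_log_derivative f \<psi>"
proof -
  obtain L where L: "L holomorphic_on unit_disc" "L 0 = 0"
    "\<And>z. z \<in> unit_disc \<Longrightarrow> z * deriv L z = \<psi> z - 1"
    by (rule log_derivative_primitive[OF assms]) (rule that)
  define f where "f = (\<lambda>z. z * exp (L z))"
  have df: "(f has_field_derivative exp (L z) * \<psi> z) (at z)" if "z \<in> unit_disc" for z
  proof -
    have "\<psi> z = 1 + z * deriv L z" using L(3)[OF that] by simp
    then show ?thesis
      unfolding f_def using holomorphic_derivI[OF L(1) open_ball that]
      by (auto intro!: derivative_eq_intros simp: algebra_simps)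
  qed
  have "f holomorphic_on unit_disc"
    unfolding holomorphic_on_open[OF open_ball] using df by blast
  then have "has_log_derivative f \<psi>"
    using DERIV_imp_deriv[OF df] assms
    by (auto simp: has_log_derivative_def normalized_analytic_def f_def L(2))
  then show ?thesis by (intro exI[of _ f])
qed

text \<open>Differentiating z f' = \<psi> f and dividing by f' gives 1 + z f'' / f' = \<psi> + z
  \<psi>' / \<psi> = \<phi>, so the identity is a Schwarz function.\<close>

lemma has_log_derivative_class_C:
  assumes \<psi>: "briot_bouquet_solution \<phi> \<psi>" and f: "has_log_derivative f \<psi>"
  shows "f \<in> class_C \<phi>"
proof -
  have hol\<psi>: "\<psi> holomorphic_on unit_disc" and \<psi>0: "\<psi> 0 = 1"
    and eq: "\<And>z. z \<in> unit_disc \<Longrightarrow> \<psi> z \<noteq> 0 \<and> \<psi> z + z * deriv \<psi> z / \<psi> z = \<phi> z"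
    using \<psi> by (auto simp: briot_bouquet_solution_def)
  have holf: "f holomorphic_on unit_disc" and f0: "f 0 = 0" "deriv f 0 = 1"
    and fnz: "\<And>z. z \<in> unit_disc \<Longrightarrow> z \<noteq> 0 \<Longrightarrow> f z \<noteq> 0 \<and> z * deriv f z / f z = \<psi> z"
    using f by (auto simp: has_log_derivative_def normalized_analytic_def)
  have zf: "z * deriv f z = \<psi> z * f z" if "z \<in> unit_disc" for z
    using fnz[OF that] f0 by (cases "z = 0") (auto simp: field_simps)
  have f'nz: "deriv f z \<noteq> 0" if "z \<in> unit_disc" for z
    using zf[OF that] f0 fnz[OF that] eq[OF that] by (cases "z = 0") auto
  have "1 + z * deriv (deriv f) z / deriv f z = \<phi> z" if z: "z \<in> unit_disc" for z
  proof (cases "z = 0")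
    case True
    then show ?thesis using eq[OF z] \<psi>0 by auto
  next
    case False
    have "((\<lambda>z. z * deriv f z) has_field_derivative deriv f z + z * deriv (deriv f) z) (at z)"
      using holomorphic_derivI[OF holomorphic_deriv[OF holf open_ball] _ z]
      by (auto intro!: derivative_eq_intros)
    moreover have "((\<lambda>z. z * deriv f z) has_field_derivative deriv \<psi> z * f z + \<psi> z * deriv f z) (at z)"
    proof (rule has_field_derivative_transform_within_open[OF _ open_ball z])
      show "((\<lambda>z. \<psi> z * f z) has_field_derivative deriv \<psi> z * f z + \<psi> z * deriv f z) (at z)"
        using holomorphic_derivI[OF holf _ z] holomorphic_derivI[OF hol\<psi> _ z]
        by (auto intro!: derivative_eq_intros)
    qed (use zf in auto)
    ultimately have "deriv f z + z * deriv (deriv f) z = deriv \<psi> z * f z + \<psi> z * deriv f z"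
      by (rule DERIV_unique)
    then have "1 + z * deriv (deriv f) z / deriv f z = deriv \<psi> z * (f z / deriv f z) + \<psi> z"
      using f'nz[OF z] by (simp add: field_simps)
    also have "f z / deriv f z = z / \<psi> z"
      using f'nz[OF z] zf[OF z] eq[OF z] by (simp add: field_simps)
    finally show ?thesis using eq[OF z] by (simp add: mult_ac add_ac)
  qed
  then have "subordinate (\<lambda>z. 1 + z * deriv (deriv f) z / deriv f z) \<phi>"
    unfolding subordinate_def by (intro exI[of _ "\<lambda>z. z"]) auto
  then show ?thesis
    using f f'nz by (simp add: class_C_def has_log_derivative_def)
qed

section \<open>Coefficients of subordinate functions\<close>

lemma norm_circlepath_0: "r \<ge> 0 \<Longrightarrow> norm (circlepath 0 r t) = r"
  by (simp add: circlepath norm_mult)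

lemma continuous_on_circlepath: "continuous_on A (circlepath c r)"
  unfolding circlepath by (intro continuous_intros)

lemma holomorphic_imp_has_fps_expansion:
  assumes "h holomorphic_on ball 0 r" "r > 0"
  shows "h has_fps_expansion fps_expansion h 0"
  using assms by (intro has_fps_expansion_fps_expansion[of "ball 0 r"]) auto

text \<open>The derivative 2 pi i z of the parametrization cancels one power of z and the constant
  in Cauchy's formula, leaving a plain mean over the parameter.\<close>

lemma circle_mean_coeff:
  assumes h: "h holomorphic_on cball 0 r" "r > 0" and H: "h has_fps_expansion H"
  shows "((\<lambda>t. h (circlepath 0 r t) / circlepath 0 r t ^ k) has_integral fps_nth H k) {0..1}"
proof -
  have "((\<lambda>u. h u / (u - 0) ^ Suc k) has_contour_integral ((2 * pi * \<i>) / (fact k) * (deriv ^^ k) h 0))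
           (circlepath 0 r)"
    using h by (intro Cauchy_has_contour_integral_higher_derivative_circlepath)
      (auto intro: holomorphic_on_imp_continuous_on holomorphic_on_subset)
  then have "((\<lambda>t. h (circlepath 0 r t) / circlepath 0 r t ^ Suc k *
     vector_derivative (circlepath 0 r) (at t within {0..1})) has_integral
      (2 * pi * \<i>) / (fact k) * (deriv ^^ k) h 0) {0..1}"
    by (simp add: has_contour_integral_def)
  then have "((\<lambda>t. 2 * pi * \<i> * (h (circlepath 0 r t) / circlepath 0 r t ^ k)) has_integral
      (2 * pi * \<i>) * fps_nth H k) {0..1}"
  proof (rule has_integral_eq_rhs[OF has_integral_eq, rotated])
    fix t :: real assume "t \<in> {0..1}"
    then have "vector_derivative (circlepath 0 r) (at t within {0..1}) = 2 * pi * \<i> * circlepath 0 r t"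
      using vector_derivative_circlepath01[of t 0 r] by (simp add: circlepath mult_ac)
    moreover have "circlepath 0 r t \<noteq> 0"
      using h(2) by (simp add: circlepath)
    ultimately show "h (circlepath 0 r t) / circlepath 0 r t ^ Suc k *
        vector_derivative (circlepath 0 r) (at t within {0..1})
        = 2 * pi * \<i> * (h (circlepath 0 r t) / circlepath 0 r t ^ k)"
      by simp
  qed (simp add: fps_nth_fps_expansion[OF H])
  from has_integral_mult_right[OF this, of "1 / (2 * pi * \<i>)"] show ?thesis
    by simp
qed

lemma circle_mean:
  assumes "h holomorphic_on cball 0 r" "r > 0"
  shows "((\<lambda>t. h (circlepath 0 r t)) has_integral h 0) {0..1}"
proof -
  have "h has_fps_expansion fps_expansion h 0"
    using assms by (intro holomorphic_imp_has_fps_expansion[of _ r]) (auto intro: holomorphic_on_subset)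
  from circle_mean_coeff[OF assms this, of 0] show ?thesis
    by (simp add: fps_expansion_def)
qed

lemma le_of_power_limit:
  fixes f :: "real \<Rightarrow> real"
  assumes "\<And>r. \<lbrakk>0 < r; r < 1\<rbrakk> \<Longrightarrow> f r \<le> b" "isCont f 1"
  shows "f 1 \<le> b"
proof (rule tendsto_upperbound)
  show "(f \<longlongrightarrow> f 1) (at_left 1)"
    using assms(2) by (simp add: isCont_def filterlim_at_split)
  show "\<forall>\<^sub>F r in at_left 1. f r \<le> b"
    using eventually_at_left_real[of 0 1] assms(1) by (auto elim!: eventually_mono)
qed simp

text \<open>Averaging the support inequality over \<open>\<bar>z\<bar> = r\<close> with \<open>\<zeta> = x z\<^sup>n / r\<^sup>n\<^sup>-\<^sup>1\<close> isolates the \<open>n\<close>-th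
  coefficient of \<open>G \<circ> w\<close>.\<close>

lemma support_coeff_bound:
  assumes G: "G holomorphic_on unit_disc" "\<And>z. z \<in> unit_disc \<Longrightarrow> deriv G z \<noteq> 0"
    and supp: "\<And>z \<zeta>. \<lbrakk>norm z \<le> norm \<zeta>; z \<noteq> \<zeta>; \<zeta> \<in> unit_disc\<rbrakk>
                  \<Longrightarrow> Re ((G z - G \<zeta>) / (\<zeta> * deriv G \<zeta>)) < 0"
    and F: "F holomorphic_on unit_disc" "F has_fps_expansion A" "subordinate F G" and n: "n \<ge> 1"
  shows "norm (fps_nth A n) \<le> norm (deriv G 0)"
proof -
  obtain w where w: "\<And>z. z \<in> unit_disc \<Longrightarrow> norm (w z) \<le> norm z"
      "\<And>z. z \<in> unit_disc \<Longrightarrow> F z = G (w z)"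
    using subordinateE[OF F(3)] by metis
  have F0: "F 0 = G 0" using w[of 0] by simp
  obtain v where v: "v holomorphic_on unit_disc" "\<And>z. z \<in> unit_disc \<Longrightarrow> G z - G 0 = z * v z" "v 0 = deriv G 0"
  proof -
    have "deriv (\<lambda>z. G z - G 0) 0 = deriv G 0"
      using holomorphic_derivI[OF G(1), of 0] by (intro DERIV_imp_deriv) (auto intro!: derivative_eq_intros)
    then show ?thesis
      using holomorphic_divide_at_zero[of "\<lambda>z. G z - G 0"] G(1) that by (force intro!: holomorphic_intros)
  qed
  have holG': "deriv G holomorphic_on unit_disc"
    using G by (auto intro: holomorphic_deriv)
  \<comment> \<open>This splits the varying factor 1 / G' at \<zeta> into its value at 0 and a
    multiple of \<zeta> that cancels the \<zeta> in the denominator.\<close>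
  obtain N where N: "N holomorphic_on unit_disc"
     "\<And>z. z \<in> unit_disc \<Longrightarrow> 1 / deriv G z - 1 / deriv G 0 = z * N z"
    by (rule holomorphic_divide_at_zero[of "\<lambda>z. 1 / deriv G z - 1 / deriv G 0"])
       (use G holG' in \<open>auto intro!: holomorphic_intros\<close>)
  have key: "Re (of_real (r ^ (n - 1)) / x * fps_nth A n / deriv G 0) \<le> 1" if r: "0 < r" "r < 1" and x: "norm x = 1" for r x
  proof -
    \<comment> \<open>The power of r normalizes |\<zeta> z| to r on the circle, so that
      \<open>supp\<close> applies to \<open>w z\<close> and \<open>\<zeta> z\<close>; the unimodular
      \<open>x\<close> is free for choosing a phase.\<close>
    define \<zeta> where "\<zeta> = (\<lambda>z. x / of_real (r ^ (n - 1)) * z ^ n)"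
    have n\<zeta>: "norm (\<zeta> z) \<le> r" if "norm z \<le> r" for z
    proof -
      have "norm z ^ n \<le> r ^ n" using that by (intro power_mono) auto
      also have "r ^ n = r * r ^ (n - 1)" using n by (simp flip: power_Suc)
      finally show ?thesis
        using x r by (simp add: \<zeta>_def norm_mult norm_divide norm_power divide_le_eq)
    qed
    have \<zeta>r: "norm (\<zeta> z) = r" if "norm z = r" for z
    proof -
      have "r ^ n = r * r ^ (n - 1)" using n by (simp flip: power_Suc)
      then show ?thesis
        using x r that by (simp add: \<zeta>_def norm_mult norm_divide norm_power)
    qed
    have hol\<zeta>: "(\<lambda>z. Q (\<zeta> z)) holomorphic_on cball 0 r" if "Q holomorphic_on unit_disc" for Q
    proof -
      have "(Q \<circ> \<zeta>) holomorphic_on cball 0 r"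
      proof (rule holomorphic_on_compose_gen[OF _ that])
        show "\<zeta> holomorphic_on cball 0 r"
          using r unfolding \<zeta>_def by (intro holomorphic_intros) auto
        show "\<zeta> ` cball 0 r \<subseteq> unit_disc"
        proof clarify
          fix z :: complex assume "z \<in> cball 0 r"
          then show "\<zeta> z \<in> unit_disc" using n\<zeta>[of z] r by simp
        qed
      qed
      then show ?thesis by (simp add: o_def)
    qed
    have sub: "cball 0 r \<subseteq> unit_disc" using r by auto
    have holF: "(\<lambda>z. F z - G 0) holomorphic_on cball 0 r"
      using F(1) sub by (intro holomorphic_intros) (auto intro: holomorphic_on_subset)
    define k where "k = of_real (r ^ (n - 1)) / x / deriv G 0"
    have "(\<lambda>z. F z - G 0) has_fps_expansion A - fps_const (G 0)"
      by (intro fps_expansion_intros F)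
    from circle_mean_coeff[OF holF r(1) this, of n]
    have 1: "((\<lambda>t. k * ((F (circlepath 0 r t) - G 0) / circlepath 0 r t ^ n)) has_integral k * fps_nth A n) {0..1}"
      using n by (intro has_integral_mult_right) auto
    have "(\<lambda>z. (F z - G 0) * N (\<zeta> z) - v (\<zeta> z) * (1 / deriv G (\<zeta> z))) holomorphic_on cball 0 r"
      by (intro holomorphic_intros holF hol\<zeta> N v hol\<zeta>[of "\<lambda>z. 1 / deriv G z"])
         (use G holG' in \<open>auto intro!: holomorphic_intros\<close>)
    \<comment> \<open>The mean of the holomorphic remainder is its value at 0. There \<zeta> = 0
      because n >= 1, the first term vanishes by \<open>F 0 = G 0\<close>, and the second is -G'(0)
      / G'(0).\<close>
    from circle_mean[OF this r(1)]
    have 2: "((\<lambda>t. (F (circlepath 0 r t) - G 0) * N (\<zeta> (circlepath 0 r t))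
               - v (\<zeta> (circlepath 0 r t)) * (1 / deriv G (\<zeta> (circlepath 0 r t)))) has_integral - 1) {0..1}"
      using n F0 v G(2)[of 0] by (simp add: \<zeta>_def power_0_left)
    have "Re (k * fps_nth A n + (- 1)) \<le> 0"
    proof (rule has_integral_le[OF has_integral_linear[OF has_integral_add[OF 1 2] bounded_linear_Re]])
      show "((\<lambda>t::real. 0::real) has_integral 0) {0..1}" by simp
      fix t :: real
      define z where "z = circlepath 0 r t"
      have nz: "norm z = r" using r by (simp add: z_def norm_circlepath_0)
      have zD: "z \<in> unit_disc" "\<zeta> z \<in> unit_disc" "\<zeta> z \<noteq> 0" "z \<noteq> 0"
        using nz \<zeta>r[OF nz] r by auto
      have "Re ((G (w z) - G (\<zeta> z)) / (\<zeta> z * deriv G (\<zeta> z))) \<le> 0"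
      proof (cases "w z = \<zeta> z")
        case False
        then show ?thesis
          using supp[of "w z" "\<zeta> z"] w(1)[OF zD(1)] zD(2) nz \<zeta>r[OF nz] by simp
      qed simp
      also have "(G (w z) - G (\<zeta> z)) / (\<zeta> z * deriv G (\<zeta> z)) =
          k * ((F z - G 0) / z ^ n) + ((F z - G 0) * N (\<zeta> z) - v (\<zeta> z) * (1 / deriv G (\<zeta> z)))"
      proof -
        have "(G (w z) - G (\<zeta> z)) / (\<zeta> z * deriv G (\<zeta> z))
            = (F z - G 0) / \<zeta> z * (1 / deriv G (\<zeta> z)) - (G (\<zeta> z) - G 0) / \<zeta> z * (1 / deriv G (\<zeta> z))"
          using w(2)[OF zD(1)] by (simp add: diff_divide_distrib)
        moreover have "(F z - G 0) / \<zeta> z * (1 / deriv G (\<zeta> z))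
            = (F z - G 0) / \<zeta> z * (1 / deriv G 0) + (F z - G 0) * N (\<zeta> z)"
        proof -
          have "1 / deriv G (\<zeta> z) = 1 / deriv G 0 + \<zeta> z * N (\<zeta> z)"
            using N(2)[OF zD(2)] by (simp add: algebra_simps)
          then show ?thesis using zD(3) by (simp add: distrib_left)
        qed
        moreover have "(F z - G 0) / \<zeta> z * (1 / deriv G 0) = k * ((F z - G 0) / z ^ n)"
          by (simp add: k_def \<zeta>_def mult_ac)
        moreover have "(G (\<zeta> z) - G 0) / \<zeta> z = v (\<zeta> z)"
          using v(2)[OF zD(2)] zD(3) by simp
        ultimately show ?thesis by simp
      qed
      finally show "(Re \<circ> (\<lambda>t. k * ((F (circlepath 0 r t) - G 0) / circlepath 0 r t ^ n) +
              ((F (circlepath 0 r t) - G 0) * N (\<zeta> (circlepath 0 r t))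
               - v (\<zeta> (circlepath 0 r t)) * (1 / deriv G (\<zeta> (circlepath 0 r t)))))) t \<le> 0"
        by (simp add: z_def)
    qed
    then show ?thesis by (simp add: k_def)
  qed
  show ?thesis
  proof (cases "fps_nth A n = 0")
    case False
    define a where "a = fps_nth A n / deriv G 0"
    have a0: "a \<noteq> 0" using False G(2)[of 0] by (simp add: a_def)
    have "norm a * 1 ^ (n - 1) \<le> 1"
    proof (rule le_of_power_limit[where f = "\<lambda>r. norm a * r ^ (n - 1)"])
      fix r :: real assume r: "0 < r" "r < 1"
      \<comment> \<open>With x equal to the phase of a, the real part in \<open>key\<close> becomes
        the modulus.\<close>
      define s where "s = sgn a"
      have "of_real (r ^ (n - 1)) / s * fps_nth A n / deriv G 0 = of_real (r ^ (n - 1)) * (a / s)"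
        by (simp add: a_def mult_ac)
      also have "a / s = of_real (norm a)"
        using a0 by (simp add: s_def sgn_eq)
      finally show "norm a * r ^ (n - 1) \<le> 1"
        using key[OF r, of s] a0 by (simp add: s_def norm_sgn mult.commute)
    qed simp
    then show ?thesis using G(2)[of 0] by (simp add: a_def norm_divide)
  qed simp
qed

section \<open>Mean squares over circles and Rogosinski's square-sum inequality\<close>

definition circle_mean_square :: "real \<Rightarrow> (complex \<Rightarrow> complex) \<Rightarrow> real" where
  "circle_mean_square r h = integral {0..1} (\<lambda>t. (norm (h (circlepath 0 r t)))\<^sup>2)"

lemma circle_mean_square_integrable:
  assumes "h holomorphic_on unit_disc" "0 < r" "r < 1"
  shows "(\<lambda>t. (norm (h (circlepath 0 r t)))\<^sup>2) integrable_on {0..1}"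
proof (rule integrable_continuous_real)
  have "continuous_on {0..1} (h \<circ> circlepath 0 r)"
    using assms by (intro continuous_on_compose continuous_on_circlepath
        continuous_on_subset[OF holomorphic_on_imp_continuous_on[OF assms(1)]])
      (auto simp: norm_circlepath_0)
  then show "continuous_on {0..1} (\<lambda>t. (norm (h (circlepath 0 r t)))\<^sup>2)"
    by (intro continuous_intros) (simp add: o_def)
qed

lemma circle_mean_square_mono:
  assumes "h holomorphic_on unit_disc" "k holomorphic_on unit_disc" "0 < r" "r < 1"
    and "\<And>z. norm z = r \<Longrightarrow> norm (h z) \<le> norm (k z)"
  shows "circle_mean_square r h \<le> circle_mean_square r k"
  unfolding circle_mean_square_def
  using assms by (intro integral_le circle_mean_square_integrable power_mono) (auto simp: norm_circlepath_0)

lemma circle_mean_square_nonneg: "circle_mean_square r h \<ge> 0"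
  unfolding circle_mean_square_def
  by (cases "(\<lambda>t. (norm (h (circlepath 0 r t)))\<^sup>2) integrable_on {0..1}")
    (auto intro!: integral_nonneg simp: not_integrable_integral)

text \<open>The cross term 2 Re (cnj c u) has mean 0, since it is the real part of a holomorphic
  function vanishing at 0.\<close>

lemma circle_mean_square_const_add:
  assumes u: "u holomorphic_on unit_disc" "u 0 = 0" and r: "0 < r" "r < 1"
  shows "circle_mean_square r (\<lambda>z. c + u z) = (norm c)\<^sup>2 + circle_mean_square r u"
proof -
  have "(\<lambda>z. 2 * cnj c * u z) holomorphic_on cball 0 r"
    using r by (intro holomorphic_intros holomorphic_on_subset[OF u(1)]) auto
  from has_integral_linear[OF circle_mean[OF this r(1)] bounded_linear_Re]
  have 1: "((\<lambda>t. Re (2 * cnj c * u (circlepath 0 r t))) has_integral 0) {0..1}"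
    using u(2) by (simp add: o_def)
  have 2: "((\<lambda>t. (norm (u (circlepath 0 r t)))\<^sup>2) has_integral circle_mean_square r u) {0..1}"
    unfolding circle_mean_square_def
    using circle_mean_square_integrable[OF u(1) r] by (rule integrable_integral)
  have 3: "((\<lambda>t::real. (norm c)\<^sup>2) has_integral (norm c)\<^sup>2) {0..1}"
    using has_integral_const_real[of "(norm c)\<^sup>2" 0 1] by simp
  have eq: "(norm (c + x))\<^sup>2 = (norm c)\<^sup>2 + (Re (2 * cnj c * x) + (norm x)\<^sup>2)" for x
    by (simp add: cmod_power2) (simp add: power2_eq_square algebra_simps)
  show ?thesis
    unfolding circle_mean_square_def[of r "\<lambda>z. c + u z"] eq
    using has_integral_add[OF 3 has_integral_add[OF 1 2]] by (simp add: integral_unique)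
qed

lemma has_fps_expansion_split_first:
  assumes q: "q holomorphic_on unit_disc" "q has_fps_expansion Q"
  obtains q' where "q' holomorphic_on unit_disc" "\<And>z. z \<in> unit_disc \<Longrightarrow> q z = fps_nth Q 0 + z * q' z"
    "q' has_fps_expansion fps_shift 1 Q"
proof -
  have q0: "q 0 = fps_nth Q 0" using q(2) by (rule has_fps_expansion_imp_0_eq_fps_nth_0)
  obtain q' where q': "q' holomorphic_on unit_disc" "\<And>z. z \<in> unit_disc \<Longrightarrow> q z - fps_nth Q 0 = z * q' z"
    by (rule holomorphic_divide_at_zero[of "\<lambda>z. q z - fps_nth Q 0"])
       (use q(1) q0 in \<open>auto intro!: holomorphic_intros\<close>)
  have eq: "q z = fps_nth Q 0 + z * q' z" if "z \<in> unit_disc" for z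
    using q'(2)[OF that] by (simp add: algebra_simps)
  define Q' where "Q' = fps_expansion q' 0"
  have Q': "q' has_fps_expansion Q'"
    unfolding Q'_def using q'(1) by (rule holomorphic_imp_has_fps_expansion) simp
  then have "(\<lambda>z. fps_nth Q 0 + z * q' z) has_fps_expansion fps_const (fps_nth Q 0) + fps_X * Q'"
    by (intro fps_expansion_intros)
  moreover have "q has_fps_expansion Q \<longleftrightarrow> (\<lambda>z. fps_nth Q 0 + z * q' z) has_fps_expansion Q"
    by (rule has_fps_expansion_cong)
      (use eq in \<open>auto intro!: eventually_mono[OF eventually_nhds_in_open[of unit_disc]]\<close>)
  ultimately have "Q = fps_const (fps_nth Q 0) + fps_X * Q'"
    using q(2) fps_expansion_unique_complex by blast
  then have "fps_nth Q (Suc k) = fps_nth (fps_const (fps_nth Q 0) + fps_X * Q') (Suc k)" for k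
    by (rule arg_cong[where f = "\<lambda>F. fps_nth F (Suc k)"])
  then have "fps_shift 1 Q = Q'"
    by (simp add: fps_eq_iff)
  then show ?thesis using that q'(1) eq Q' by blast
qed

lemma taylor_remainder_holomorphic:
  assumes "q holomorphic_on unit_disc" "q has_fps_expansion Q"
  shows "\<exists>R. R holomorphic_on unit_disc \<and>
     (\<forall>z\<in>unit_disc. q z = (\<Sum>k<n. fps_nth Q k * z ^ k) + z ^ n * R z)"
  using assms
proof (induction n arbitrary: q Q)
  case 0
  then show ?case by auto
next
  case (Suc n)
  obtain q' where q': "q' holomorphic_on unit_disc" "\<And>z. z \<in> unit_disc \<Longrightarrow> q z = fps_nth Q 0 + z * q' z"
    "q' has_fps_expansion fps_shift 1 Q"
    using has_fps_expansion_split_first[OF Suc.prems] by metis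
  obtain R where R: "R holomorphic_on unit_disc"
     "\<And>z. z \<in> unit_disc \<Longrightarrow> q' z = (\<Sum>k<n. fps_nth (fps_shift 1 Q) k * z ^ k) + z ^ n * R z"
    using Suc.IH[OF q'(1,3)] by blast
  have "q z = (\<Sum>k<Suc n. fps_nth Q k * z ^ k) + z ^ Suc n * R z" if "z \<in> unit_disc" for z
    using q'(2)[OF that] R(2)[OF that]
    by (simp add: sum.lessThan_Suc_shift algebra_simps sum_distrib_left del: sum.lessThan_Suc)
  then show ?case using R(1) by blast
qed

text \<open>A finite form of Parseval: the constant term splits off by orthogonality, the rest is z
  q with |z| = r on the circle, and induction treats \<open>q\<close>.\<close>

lemma bessel_circle_mean_square:
  assumes "h holomorphic_on unit_disc" "h has_fps_expansion H" and r: "0 < r" "r < 1"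
  shows "(\<Sum>k<n. (norm (fps_nth H k))\<^sup>2 * r ^ (2 * k)) \<le> circle_mean_square r h"
  using assms(1,2)
proof (induction n arbitrary: h H)
  case 0
  then show ?case by (simp add: circle_mean_square_nonneg)
next
  case (Suc n)
  obtain q where q: "q holomorphic_on unit_disc" "\<And>z. z \<in> unit_disc \<Longrightarrow> h z = fps_nth H 0 + z * q z"
    "q has_fps_expansion fps_shift 1 H"
    using has_fps_expansion_split_first[OF Suc.prems] by metis
  have "(\<Sum>k<Suc n. (norm (fps_nth H k))\<^sup>2 * r ^ (2 * k))
      = (norm (fps_nth H 0))\<^sup>2 + r\<^sup>2 * (\<Sum>k<n. (norm (fps_nth (fps_shift 1 H) k))\<^sup>2 * r ^ (2 * k))"
    by (simp add: sum.lessThan_Suc_shift sum_distrib_left power2_eq_square mult_ac del: sum.lessThan_Suc)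
  also have "\<dots> \<le> (norm (fps_nth H 0))\<^sup>2 + r\<^sup>2 * circle_mean_square r q"
    using Suc.IH[OF q(1,3)] by (intro add_left_mono mult_left_mono) auto
  also have "r\<^sup>2 * circle_mean_square r q = circle_mean_square r (\<lambda>z. z * q z)"
    using r by (simp add: circle_mean_square_def norm_mult norm_circlepath_0 power_mult_distrib)
  also have "(norm (fps_nth H 0))\<^sup>2 + \<dots> = circle_mean_square r (\<lambda>z. fps_nth H 0 + z * q z)"
    using r by (intro circle_mean_square_const_add[symmetric] holomorphic_intros q) auto
  also have "\<dots> = circle_mean_square r h"
    unfolding circle_mean_square_def using q(2) r by (simp add: norm_circlepath_0)
  finally show ?case .
qed

text \<open>Littlewood's subordination inequality for polynomials: constants are orthogonal to functions
  vanishing at \<open>0\<close>, and multiplication by \<open>w\<close> does not increase the mean square.\<close>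

lemma littlewood_polynomial:
  assumes w: "w holomorphic_on unit_disc" "\<And>z. z \<in> unit_disc \<Longrightarrow> norm (w z) \<le> norm z"
    and r: "0 < r" "r < 1"
  shows "circle_mean_square r (\<lambda>z. \<Sum>k<n. a k * w z ^ k) \<le> (\<Sum>k<n. (norm (a k))\<^sup>2)"
proof (induction n arbitrary: a)
  case 0
  then show ?case by (simp add: circle_mean_square_def)
next
  case (Suc n)
  let ?T = "\<lambda>z. \<Sum>k<n. a (Suc k) * w z ^ k"
  have w0: "w 0 = 0" using w(2)[of 0] by simp
  have "circle_mean_square r (\<lambda>z. \<Sum>k<Suc n. a k * w z ^ k) = circle_mean_square r (\<lambda>z. a 0 + w z * ?T z)"
    by (simp add: sum.lessThan_Suc_shift sum_distrib_left mult_ac del: sum.lessThan_Suc)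
  also have "\<dots> = (norm (a 0))\<^sup>2 + circle_mean_square r (\<lambda>z. w z * ?T z)"
    using r w0 by (intro circle_mean_square_const_add holomorphic_intros w) auto
  also have "circle_mean_square r (\<lambda>z. w z * ?T z) \<le> circle_mean_square r ?T"
  proof (rule circle_mean_square_mono)
    fix z :: complex assume "norm z = r"
    then have "norm (w z) \<le> 1" using w(2)[of z] r by simp
    then show "norm (w z * ?T z) \<le> norm (?T z)"
      by (simp add: norm_mult mult_left_le_one_le)
  qed (use r in \<open>auto intro!: holomorphic_intros w\<close>)
  also have "circle_mean_square r ?T \<le> (\<Sum>k<n. (norm (a (Suc k)))\<^sup>2)"
    by (rule Suc.IH)
  also have "(norm (a 0))\<^sup>2 + \<dots> = (\<Sum>k<Suc n. (norm (a k))\<^sup>2)"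
    by (simp add: sum.lessThan_Suc_shift del: sum.lessThan_Suc)
  finally show ?case by simp
qed

text \<open>Because w is divisible by z, cutting the series of \<open>q\<close> after n terms alters
  q(w(z)) only by a multiple of z^n. So the first n coefficients of \<open>p\<close> are those of a
  polynomial in \<open>w\<close>, to which the Bessel and Littlewood inequalities apply; then r
  tends to 1.\<close>

lemma rogosinski_square_sum:
  assumes p: "p holomorphic_on unit_disc" "p has_fps_expansion P"
    and q: "q holomorphic_on unit_disc" "q has_fps_expansion Q" and sub: "subordinate p q"
  shows "(\<Sum>k<n. (norm (fps_nth P k))\<^sup>2) \<le> (\<Sum>k<n. (norm (fps_nth Q k))\<^sup>2)"
proof -
  obtain w where w: "w holomorphic_on unit_disc" "\<And>z. z \<in> unit_disc \<Longrightarrow> norm (w z) \<le> norm z"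
      "\<And>z. z \<in> unit_disc \<Longrightarrow> p z = q (w z)"
    using subordinateE[OF sub] by metis
  have w0: "w 0 = 0" using w(2)[of 0] by simp
  obtain v where v: "v holomorphic_on unit_disc" "\<And>z. z \<in> unit_disc \<Longrightarrow> w z = z * v z"
    using holomorphic_divide_at_zero[OF w(1) w0] by metis
  obtain R where R: "R holomorphic_on unit_disc"
     "\<And>z. z \<in> unit_disc \<Longrightarrow> q z = (\<Sum>k<n. fps_nth Q k * z ^ k) + z ^ n * R z"
    using taylor_remainder_holomorphic[OF q] by blast
  have wD: "w z \<in> unit_disc" if "z \<in> unit_disc" for z
    using w(2)[OF that] that by simp
  define S where "S = (\<lambda>z. \<Sum>k<n. fps_nth Q k * w z ^ k)"
  have holS: "S holomorphic_on unit_disc"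
    unfolding S_def by (intro holomorphic_intros w)
  define T where "T = (\<lambda>z. v z ^ n * R (w z))"
  have "(R \<circ> w) holomorphic_on unit_disc"
    using wD by (intro holomorphic_on_compose_gen[OF w(1) R(1)]) auto
  then have holT: "T holomorphic_on unit_disc"
    unfolding T_def by (intro holomorphic_intros v) (simp add: o_def)
  have eq: "p z = S z + z ^ n * T z" if "z \<in> unit_disc" for z
    using w(3)[OF that] R(2)[OF wD[OF that]] v(2)[OF that]
    by (simp add: S_def T_def power_mult_distrib)
  have "(\<lambda>z. S z + z ^ n * T z) has_fps_expansion fps_expansion S 0 + fps_X ^ n * fps_expansion T 0"
    by (intro fps_expansion_intros holomorphic_imp_has_fps_expansion[OF holS]
        holomorphic_imp_has_fps_expansion[OF holT]) auto
  moreover have "p has_fps_expansion P \<longleftrightarrow> (\<lambda>z. S z + z ^ n * T z) has_fps_expansion P"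
    by (rule has_fps_expansion_cong)
      (use eq in \<open>auto intro!: eventually_mono[OF eventually_nhds_in_open[of unit_disc]]\<close>)
  ultimately have PS: "P = fps_expansion S 0 + fps_X ^ n * fps_expansion T 0"
    using p(2) fps_expansion_unique_complex by blast
  have coeff: "fps_nth P k = fps_nth (fps_expansion S 0) k" if "k < n" for k
    using that by (simp add: PS fps_X_power_mult_nth)
  have "(\<Sum>k<n. (norm (fps_nth P k))\<^sup>2 * 1 ^ (2 * k)) \<le> (\<Sum>k<n. (norm (fps_nth Q k))\<^sup>2)"
  proof (rule le_of_power_limit[where f = "\<lambda>r. \<Sum>k<n. (norm (fps_nth P k))\<^sup>2 * r ^ (2 * k)"])
    fix r :: real assume r: "0 < r" "r < 1"
    have "(\<Sum>k<n. (norm (fps_nth P k))\<^sup>2 * r ^ (2 * k))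
        = (\<Sum>k<n. (norm (fps_nth (fps_expansion S 0) k))\<^sup>2 * r ^ (2 * k))"
      by (intro sum.cong) (auto simp: coeff)
    also have "\<dots> \<le> circle_mean_square r S"
      by (rule bessel_circle_mean_square[OF holS holomorphic_imp_has_fps_expansion[OF holS] r]) simp
    also have "\<dots> \<le> (\<Sum>k<n. (norm (fps_nth Q k))\<^sup>2)"
      unfolding S_def by (rule littlewood_polynomial[OF w(1,2) r])
    finally show "(\<Sum>k<n. (norm (fps_nth P k))\<^sup>2 * r ^ (2 * k)) \<le> (\<Sum>k<n. (norm (fps_nth Q k))\<^sup>2)" .
  qed (intro continuous_intros)
  then show ?thesis by simp
qed

section \<open>Primitives of starlike functions\<close>

text \<open>Alexander's correspondence: z G' = \<psi> - a is starlike exactly when G is convex. Of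
  the convexity of G, only the support inequality and univalence are extracted below.\<close>

locale starlike_primitive =
  fixes \<psi> G :: "complex \<Rightarrow> complex" and a :: complex
  assumes starlike: "starlike_function_wrt a \<psi>" and \<psi>0: "\<psi> 0 = a"
    and hol: "G holomorphic_on unit_disc"
    and ode: "\<And>z. z \<in> unit_disc \<Longrightarrow> z * deriv G z = \<psi> z - a"
begin

lemma hol\<psi>: "\<psi> holomorphic_on unit_disc" and inj\<psi>: "inj_on \<psi> unit_disc"
  using starlike by (auto simp: starlike_function_wrt_def)

lemma hol_deriv: "deriv G holomorphic_on unit_disc"
  using hol by (auto intro: holomorphic_deriv)

lemma deriv_\<psi>:
  assumes "z \<in> unit_disc"
  shows "deriv \<psi> z = deriv G z + z * deriv (deriv G) z"
proof -
  have "((\<lambda>z. a + z * deriv G z) has_field_derivative deriv G z + z * deriv (deriv G) z) (at z)"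
    using holomorphic_derivI[OF hol_deriv _ assms] by (auto intro!: derivative_eq_intros)
  then have "(\<psi> has_field_derivative deriv G z + z * deriv (deriv G) z) (at z)"
    by (rule has_field_derivative_transform_within_open[OF _ open_ball assms]) (use ode in auto)
  then show ?thesis by (rule DERIV_imp_deriv)
qed

lemma deriv_G_0: "deriv G 0 = deriv \<psi> 0"
  using deriv_\<psi>[of 0] by simp

lemma deriv_nonzero:
  assumes "z \<in> unit_disc"
  shows "deriv G z \<noteq> 0"
proof (cases "z = 0")
  case True
  then show ?thesis
    using deriv_G_0 holomorphic_injective_imp_regular[OF hol\<psi> open_ball inj\<psi>, of 0] by simp
next
  case False
  then have "\<psi> z \<noteq> \<psi> 0"
    using inj_onD[OF inj\<psi>, of z 0] assms by auto
  then show ?thesis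
    using ode[OF assms] \<psi>0 by auto
qed

text \<open>Along a circle the tangent of \<open>G\<close> turns monotonically and exactly once, so \<open>Re (G / N)\<close>
  first decreases and then increases, where \<open>N\<close> is the outer normal at \<open>\<zeta>\<close>.\<close>

lemma support_circle:
  assumes \<zeta>: "\<zeta> \<in> unit_disc" "\<zeta> \<noteq> 0" and s: "0 < s" "s < 2 * pi"
  shows "Re (G (\<zeta> * cis s) * cnj (\<zeta> * deriv G \<zeta>)) < Re (G \<zeta> * cnj (\<zeta> * deriv G \<zeta>))"
proof -
  obtain l where l: "l holomorphic_on unit_disc" "\<And>z. z \<in> unit_disc \<Longrightarrow> exp (l z) = deriv G z"
    using holomorphic_logarithm_exists[OF convex_ball open_ball hol_deriv deriv_nonzero, where ?z0.0 = 0] by auto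
  have dl: "(l has_field_derivative deriv l z) (at z)" if "z \<in> unit_disc" for z
    using holomorphic_derivI[OF l(1) _ that] by auto
  \<comment> \<open>With \<open>l\<close> a logarithm of G', this expression is Re (1 + z G'' / G')
    = Re (z \<psi>' / (\<psi> - a)); starlikeness makes the reciprocal have positive real
    part.\<close>
  have pos: "1 + Re (z * deriv l z) > 0" if z: "z \<in> unit_disc" "z \<noteq> 0" for z
  proof -
    have "((\<lambda>z. exp (l z)) has_field_derivative exp (l z) * deriv l z) (at z)"
      using dl[OF z(1)] by (auto intro!: derivative_eq_intros)
    then have "(deriv G has_field_derivative exp (l z) * deriv l z) (at z)"
      by (rule has_field_derivative_transform_within_open[OF _ open_ball z(1)]) (use l in auto)
    then have "deriv (deriv G) z = deriv G z * deriv l z"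
      using l(2)[OF z(1)] by (simp add: DERIV_imp_deriv)
    then have "z * deriv \<psi> z = (\<psi> z - a) * (1 + z * deriv l z)"
      using deriv_\<psi>[OF z(1)] ode[OF z(1)] by (simp add: algebra_simps flip: ode[OF z(1)])
    moreover have "Re ((\<psi> z - a) / (z * deriv \<psi> z)) > 0"
      by (rule starlike_function_Re_pos[OF starlike \<psi>0 z])
    moreover have "\<psi> z - a \<noteq> 0"
      using ode[OF z(1)] deriv_nonzero[OF z(1)] z(2) by (metis mult_eq_0_iff)
    ultimately have "Re (1 / (1 + z * deriv l z)) > 0" by simp
    then show ?thesis by (simp add: Re_divide zero_less_divide_iff not_less) (smt (verit) zero_le_power2)
  qed
  define x where "x = (\<lambda>t. \<zeta> * cis t)"
  have xD: "x t \<in> unit_disc" "x t \<noteq> 0" for t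
    using \<zeta> by (auto simp: x_def norm_mult)
  have dx: "(x has_vector_derivative \<i> * x t) (at t)" for t
    unfolding x_def cis_conv_exp
    by (rule has_vector_derivative_real_field) (auto intro!: derivative_eq_intros)
  \<comment> \<open>The angle by which the normal z G'(z) has turned between \<zeta> and
    \<open>x t\<close>: \<open>t\<close> from the factor z, the rest from the argument of
    G'.\<close>
  define \<alpha> where "\<alpha> = (\<lambda>t. t + Im (l (x t)) - Im (l \<zeta>))"
  define \<kappa> where "\<kappa> = (\<lambda>t. Re (G (x t) * cnj (\<zeta> * deriv G \<zeta>)))"
  have d\<alpha>: "(\<alpha> has_real_derivative 1 + Re (x t * deriv l (x t))) (at t)" for t
  proof -
    have "((\<lambda>t. l (x t)) has_vector_derivative \<i> * x t * deriv l (x t)) (at t)"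
      using field_vector_diff_chain_at[OF dx dl[OF xD(1)]] by (simp add: o_def)
    from bounded_linear.has_vector_derivative[OF bounded_linear_Im this]
    have "((\<lambda>t. Im (l (x t))) has_real_derivative Re (x t * deriv l (x t))) (at t)"
      by (simp add: has_real_derivative_iff_has_vector_derivative mult.assoc)
    then show ?thesis
      unfolding \<alpha>_def using DERIV_diff[OF DERIV_add[OF DERIV_ident] DERIV_const] by fastforce
  qed
  have \<alpha>_mono: "\<alpha> t < \<alpha> t'" if "t < t'" for t t'
  proof (rule DERIV_pos_imp_increasing[OF that])
    show "\<exists>y. (\<alpha> has_real_derivative y) (at u) \<and> y > 0" for u
      using d\<alpha>[of u] pos[OF xD, of u] by blast
  qed
  have \<alpha>0: "\<alpha> 0 = 0" "\<alpha> (2 * pi) = 2 * pi"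
    by (simp_all add: \<alpha>_def x_def cis_2pi)
  have cont\<alpha>: "continuous_on A \<alpha>" for A
    using d\<alpha> by (meson DERIV_continuous continuous_at_imp_continuous_on)
  obtain t0 where t0: "0 \<le> t0" "t0 \<le> 2 * pi" "\<alpha> t0 = pi"
    using IVT'[of \<alpha> 0 pi "2 * pi"] \<alpha>0 cont\<alpha> pi_gt_zero by auto
  \<comment> \<open>The modulus in the polar form \<open>N t * cis (\<alpha> t)\<close> of the
    normal at \<open>x t\<close> times the conjugate normal at \<zeta>. Differentiating \<kappa>
    multiplies this by i, whence the sine.\<close>
  define N where "N = (\<lambda>t. (norm (\<zeta> * deriv G \<zeta>))\<^sup>2 * exp (Re (l (x t) - l \<zeta>)))"
  have N: "N t > 0" for t
    using \<zeta> deriv_nonzero[OF \<zeta>(1)] by (simp add: N_def)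
  have d\<kappa>: "(\<kappa> has_real_derivative - N t * sin (\<alpha> t)) (at t)" for t
  proof -
    have "((\<lambda>t. G (x t)) has_vector_derivative \<i> * x t * deriv G (x t)) (at t)"
      using field_vector_diff_chain_at[OF dx holomorphic_derivI[OF hol open_ball xD(1)]] by (simp add: o_def)
    then have "((\<lambda>t. G (x t) * cnj (\<zeta> * deriv G \<zeta>)) has_vector_derivative
        \<i> * x t * deriv G (x t) * cnj (\<zeta> * deriv G \<zeta>)) (at t)"
      by (rule has_vector_derivative_mult_left)
    from bounded_linear.has_vector_derivative[OF bounded_linear_Re this]
    have "(\<kappa> has_real_derivative Re (\<i> * x t * deriv G (x t) * cnj (\<zeta> * deriv G \<zeta>))) (at t)"
      by (simp add: has_real_derivative_iff_has_vector_derivative \<kappa>_def)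
    also have "\<i> * x t * deriv G (x t) * cnj (\<zeta> * deriv G \<zeta>)
        = of_real (N t) * (\<i> * cis (\<alpha> t))"
    proof -
      have "x t * deriv G (x t) = \<zeta> * deriv G \<zeta> * (cis t * exp (l (x t) - l \<zeta>))"
        using l(2)[OF xD(1), of t] l(2)[OF \<zeta>(1)] deriv_nonzero[OF \<zeta>(1)]
        by (simp add: exp_diff x_def)
      also have "cis t * exp (l (x t) - l \<zeta>) = of_real (exp (Re (l (x t) - l \<zeta>))) * cis (\<alpha> t)"
      proof -
        have \<alpha>: "\<alpha> t = t + Im (l (x t) - l \<zeta>)" by (simp add: \<alpha>_def)
        show ?thesis
          unfolding \<alpha> cis_mult[symmetric] by (subst exp_eq_polar) (simp only: mult_ac)
      qed
      finally have "x t * deriv G (x t) * cnj (\<zeta> * deriv G \<zeta>)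
          = (\<zeta> * deriv G \<zeta>) * cnj (\<zeta> * deriv G \<zeta>) * (of_real (exp (Re (l (x t) - l \<zeta>))) * cis (\<alpha> t))"
        by (simp only: mult_ac)
      also have "(\<zeta> * deriv G \<zeta>) * cnj (\<zeta> * deriv G \<zeta>) = of_real ((norm (\<zeta> * deriv G \<zeta>))\<^sup>2)"
        by (simp only: complex_norm_square)
      finally show ?thesis
        by (simp only: N_def of_real_mult mult_ac)
    qed
    also have "Re (of_real (N t) * (\<i> * cis (\<alpha> t))) = - N t * sin (\<alpha> t)"
      by simp
    finally show ?thesis .
  qed
  \<comment> \<open>The angle \<alpha> passes pi exactly once, at \<open>t0\<close>. Before it
    \<kappa> falls from \<kappa> 0, after it \<kappa> rises to \<kappa> (2 pi) = \<kappa> 0.\<close>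
  have "\<kappa> s < \<kappa> 0"
  proof (cases "s \<le> t0")
    case True
    show ?thesis
    proof (rule DERIV_neg_imp_decreasing_open[OF s(1)])
      fix t assume t: "0 < t" "t < s"
      have "0 < \<alpha> t" "\<alpha> t < pi"
        using \<alpha>_mono[OF t(1)] \<alpha>_mono[of t t0] t True t0 \<alpha>0 by auto
      then have "sin (\<alpha> t) > 0" by (rule sin_gt_zero)
      then show "\<exists>y. (\<kappa> has_real_derivative y) (at t) \<and> y < 0"
        using d\<kappa>[of t] N[of t] by (intro exI[of _ "- N t * sin (\<alpha> t)"]) simp
    qed (use d\<kappa> in \<open>meson DERIV_continuous continuous_at_imp_continuous_on\<close>)
  next
    case False
    have "\<kappa> s < \<kappa> (2 * pi)"
    proof (rule DERIV_pos_imp_increasing_open[OF s(2)])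
      fix t assume t: "s < t" "t < 2 * pi"
      have "pi < \<alpha> t" "\<alpha> t < 2 * pi"
        using \<alpha>_mono[OF t(2)] \<alpha>_mono[of t0 t] t False t0 \<alpha>0 by auto
      then have "sin (\<alpha> t) < 0" by (rule sin_lt_zero)
      then show "\<exists>y. (\<kappa> has_real_derivative y) (at t) \<and> y > 0"
        using d\<kappa>[of t] N[of t] by (intro exI[of _ "- N t * sin (\<alpha> t)"]) (simp add: mult_less_0_iff)
    qed (use d\<kappa> in \<open>meson DERIV_continuous continuous_at_imp_continuous_on\<close>)
    then show ?thesis by (simp add: \<kappa>_def x_def cis_2pi)
  qed
  then show ?thesis by (simp add: \<kappa>_def x_def)
qed

text \<open>The maximum principle for exp ((G x - G \<zeta>) cnj N) carries the inequality from the
  circle to the disc. Multiplying by cnj N instead of dividing by N changes the real part only by a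
  positive factor.\<close>

lemma support:
  assumes z: "norm z \<le> norm \<zeta>" "z \<noteq> \<zeta>" and \<zeta>: "\<zeta> \<in> unit_disc"
  shows "Re ((G z - G \<zeta>) / (\<zeta> * deriv G \<zeta>)) < 0"
proof -
  define N where "N = \<zeta> * deriv G \<zeta>"
  have \<zeta>0: "\<zeta> \<noteq> 0" using z by auto
  have N0: "N \<noteq> 0" using \<zeta>0 deriv_nonzero[OF \<zeta>] by (simp add: N_def)
  have circle: "Re ((G x - G \<zeta>) * cnj N) < 0" if x: "norm x = norm \<zeta>" "x \<noteq> \<zeta>" for x
  proof -
    define s where "s = Arg2pi (x / \<zeta>)"
    have "x / \<zeta> = cis s"
      using Arg2pi_eq[of "x / \<zeta>"] x(1) \<zeta>0 by (simp add: s_def norm_divide cis_conv_exp)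
    then have xs: "x = \<zeta> * cis s" using \<zeta>0 by (simp add: field_simps)
    have "s \<noteq> 0" using xs x(2) by auto
    then have "0 < s" "s < 2 * pi"
      using Arg2pi_ge_0[of "x / \<zeta>"] Arg2pi_lt_2pi[of "x / \<zeta>"] by (auto simp: s_def)
    from support_circle[OF \<zeta> \<zeta>0 this] show ?thesis
      by (simp add: xs N_def algebra_simps)
  qed
  have "Re ((G z - G \<zeta>) * cnj N) < 0"
  proof (cases "norm z = norm \<zeta>")
    case True
    then show ?thesis using circle z by simp
  next
    case False
    define H where "H = (\<lambda>x. exp ((G x - G \<zeta>) * cnj N))"
    have holH: "H holomorphic_on unit_disc"
      unfolding H_def by (intro holomorphic_intros hol)
    have le: "norm (H x) \<le> 1" if "norm x \<le> norm \<zeta>" for x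
    proof (rule maximum_modulus_frontier[of H "cball 0 (norm \<zeta>)"])
      show "H holomorphic_on interior (cball 0 (norm \<zeta>))"
        using \<zeta> by (intro holomorphic_on_subset[OF holH]) auto
      show "continuous_on (closure (cball 0 (norm \<zeta>))) H"
        using \<zeta> by (intro continuous_on_subset[OF holomorphic_on_imp_continuous_on[OF holH]]) auto
      show "norm (H x) \<le> 1" if "x \<in> frontier (cball 0 (norm \<zeta>))" for x
        using circle[of x] that by (cases "x = \<zeta>") (auto simp: H_def)
    qed (use that in auto)
    show ?thesis
    proof (rule ccontr)
      assume "\<not> ?thesis"
      then have "norm (H z) \<ge> 1" by (simp add: H_def)
      then have "H constant_on ball 0 (norm \<zeta>)"
        using le z False \<zeta>
        by (intro maximum_modulus_principle[where U = "ball 0 (norm \<zeta>)" and \<xi> = z] holomorphic_on_subset[OF holH])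
           (auto intro!: order_trans[OF le \<open>norm (H z) \<ge> 1\<close>])
      then obtain c where c: "\<And>x. x \<in> ball 0 (norm \<zeta>) \<Longrightarrow> c = H x"
        by (auto simp: constant_on_def)
      \<comment> \<open>Constancy of \<open>H\<close> is refuted at 0, where its derivative is a
        nonzero multiple of G'(0).\<close>
      have "(H has_field_derivative 0) (at 0)"
        by (rule has_field_derivative_transform_within_open[of "\<lambda>x. c" _ _ "ball 0 (norm \<zeta>)"])
           (use \<zeta>0 c in auto)
      moreover have "(H has_field_derivative H 0 * (deriv G 0 * cnj N)) (at 0)"
        unfolding H_def using holomorphic_derivI[OF hol, of 0] by (auto intro!: derivative_eq_intros)
      ultimately have "H 0 * (deriv G 0 * cnj N) = 0" by (rule DERIV_unique[symmetric])
      then show False using N0 deriv_nonzero[of 0] by (simp add: H_def)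
    qed
  qed
  moreover have "(G z - G \<zeta>) / N = of_real (1 / (norm N)\<^sup>2) * ((G z - G \<zeta>) * cnj N)"
    using N0 by (simp add: complex_div_cnj[of _ N])
  then have "Re ((G z - G \<zeta>) / N) = 1 / (norm N)\<^sup>2 * Re ((G z - G \<zeta>) * cnj N)"
    by (simp only: Re_of_real_mult)
  ultimately show ?thesis
    unfolding N_def[symmetric] using N0 mult_pos_neg[of "1 / (norm N)\<^sup>2"] by simp
qed

lemma inj: "inj_on G unit_disc"
proof (rule inj_onI, rule ccontr)
  fix x y assume "x \<in> unit_disc" "y \<in> unit_disc" "G x = G y" "x \<noteq> y"
  then show False
    using support[of x y] support[of y x] by (cases "norm x \<le> norm y") auto
qed

text \<open>A contact point yields \<psi>(w z) - a = m (\<psi> \<zeta> - a) with m >= 1 and |w z| <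
  |\<zeta>|. Contraction towards \<open>a\<close> by 1/m is subordinate to \<psi>, so \<psi> takes
  the value \<psi> \<zeta> again at a point of modulus below |\<zeta>|, against univalence.\<close>

lemma subordinate_primitive:
  assumes F: "F holomorphic_on unit_disc" "F 0 = G 0"
    and p: "\<And>z. z \<in> unit_disc \<Longrightarrow> z * deriv F z = p z - a" "subordinate p \<psi>"
  shows "subordinate F G"
proof (rule subordinateI_contact[OF F(1) hol inj F(2)])
  fix z \<zeta> and m :: real
  assume z: "z \<noteq> 0" "norm z < norm \<zeta>" "norm \<zeta> < 1" "1 \<le> m" "F z = G \<zeta>"
    "z * deriv F z = of_real m * (\<zeta> * deriv G \<zeta>)"
  obtain w where w: "\<And>z. z \<in> unit_disc \<Longrightarrow> norm (w z) \<le> norm z"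
      "\<And>z. z \<in> unit_disc \<Longrightarrow> p z = \<psi> (w z)"
    using subordinateE[OF p(2)] by metis
  have "subordinate (\<lambda>x. a + of_real (1 / m) * (\<psi> x - a)) \<psi>"
  proof (rule subordinateI_univalent[OF _ hol\<psi> inj\<psi>])
    fix x assume "x \<in> unit_disc"
    then have "closed_segment a (\<psi> x) \<subseteq> \<psi> ` unit_disc"
      using starlike by (auto simp: starlike_function_wrt_def)
    moreover have "a + of_real (1 / m) * (\<psi> x - a) \<in> closed_segment a (\<psi> x)"
      unfolding in_segment using z(4)
      by (intro exI[of _ "1 / m"]) (auto simp: scaleR_conv_of_real algebra_simps diff_divide_distrib)
    ultimately show "a + of_real (1 / m) * (\<psi> x - a) \<in> \<psi> ` unit_disc" by blast
  qed (use \<psi>0 in \<open>auto intro!: holomorphic_intros hol\<psi>\<close>)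
  then obtain v where v: "\<And>x. x \<in> unit_disc \<Longrightarrow> norm (v x) \<le> norm x"
      "\<And>x. x \<in> unit_disc \<Longrightarrow> a + of_real (1 / m) * (\<psi> x - a) = \<psi> (v x)"
    by (rule subordinateE) (rule that)
  have wz: "norm (w z) < norm \<zeta>" "w z \<in> unit_disc"
    using w(1)[of z] z by auto
  have "\<psi> (w z) - a = of_real m * (\<psi> \<zeta> - a)"
    using z p(1)[of z] ode[of \<zeta>] w(2)[of z] by simp
  then have "\<psi> \<zeta> = \<psi> (v (w z))"
    using v(2)[OF wz(2)] z(4) by (simp add: field_simps)
  then have "\<zeta> = v (w z)"
    using inj_onD[OF inj\<psi>, of \<zeta> "v (w z)"] v(1)[OF wz(2)] wz z by auto
  then show False using v(1)[OF wz(2)] wz by simp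
qed

end

section \<open>Logarithmic coefficients\<close>

text \<open>Abel summation: decreasing weights preserve a comparison of all partial sums. It inserts
  the weights 1 / (4 m^2) into Rogosinski's inequality.\<close>

lemma weighted_sum_mono:
  fixes x y w :: "nat \<Rightarrow> real"
  assumes le: "\<And>n. sum x {..<n} \<le> sum y {..<n}" and w: "decseq w" "\<And>n. w n \<ge> 0"
  shows "(\<Sum>k<n. w k * x k) \<le> (\<Sum>k<n. w k * y k)"
proof -
  have *: "w n * (sum y {..<Suc n} - sum x {..<Suc n}) \<le> (\<Sum>k<Suc n. w k * (y k - x k))" for n
  proof (induction n)
    case (Suc n)
    let ?D = "sum y {..<Suc n} - sum x {..<Suc n}"
    have "w (Suc n) * ?D \<le> w n * ?D"
      using le[of "Suc n"] w(1) by (intro mult_right_mono) (auto simp: decseq_Suc_iff simp del: sum.lessThan_Suc)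
    moreover have "sum y {..<Suc (Suc n)} - sum x {..<Suc (Suc n)} = ?D + (y (Suc n) - x (Suc n))"
      by simp
    ultimately show ?case
      using Suc.IH by (simp only: distrib_left sum.lessThan_Suc[of _ "Suc n"])
  qed (simp add: algebra_simps)
  show ?thesis
  proof (cases n)
    case (Suc k)
    have "0 \<le> w k * (sum y {..<Suc k} - sum x {..<Suc k})"
      using w(2) le[of "Suc k"] by simp
    also note *[of k]
    finally show ?thesis using Suc by (simp add: algebra_simps sum_subtractf)
  qed simp
qed

text \<open>Both terms on the left of the equation contribute \<psi>'(0) because \<psi> 0 = 1. This
  is how |c_1| / 2 becomes |B_1| / 4.\<close>

lemma briot_bouquet_deriv_0:
  assumes "briot_bouquet_solution \<phi> \<psi>"
  shows "deriv \<phi> 0 = 2 * deriv \<psi> 0"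
proof -
  have hol: "\<psi> holomorphic_on unit_disc" and \<psi>0: "\<psi> 0 = 1"
    and eq: "\<And>z. z \<in> unit_disc \<Longrightarrow> \<psi> z + z * deriv \<psi> z / \<psi> z = \<phi> z"
    using assms by (auto simp: briot_bouquet_solution_def)
  have "((\<lambda>z. \<psi> z + z * deriv \<psi> z / \<psi> z) has_field_derivative 2 * deriv \<psi> 0) (at 0)"
    using holomorphic_derivI[OF hol, of 0] holomorphic_derivI[OF holomorphic_deriv[OF hol], of 0] \<psi>0
    by (auto intro!: derivative_eq_intros)
  then have "(\<phi> has_field_derivative 2 * deriv \<psi> 0) (at 0)"
    by (rule has_field_derivative_transform_within_open[where S = unit_disc]) (use eq in auto)
  then show ?thesis by (rule DERIV_imp_deriv)
qed

lemma has_fps_expansion_nth_1: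
  fixes f :: "complex \<Rightarrow> complex"
  assumes "f has_fps_expansion F"
  shows "fps_nth F 1 = deriv f 0"
  using fps_nth_fps_expansion[OF assms, of 1] by simp

lemma summable_inverse_squares_Suc: "summable (\<lambda>m. C / (real (Suc m))\<^sup>2)"
proof -
  have "summable (\<lambda>m. inverse ((real (Suc m)) ^ 2))"
    using inverse_power_summable[of 2, where 'a = real] by (subst summable_Suc_iff) simp
  from summable_mult[OF this, of C] show ?thesis
    by (simp add: field_class.field_divide_inverse)
qed

section \<open>Bounds for the logarithmic coefficients in the convex and the starlike case\<close>

locale briot_bouquet_data =
  fixes \<phi> \<psi> :: "complex \<Rightarrow> complex" and c :: "complex fps"
  assumes \<phi>: "convex_function \<phi>" "\<And>z. z \<in> unit_disc \<Longrightarrow> Re (\<phi> z) > 0" "\<phi> 0 = 1"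
    and \<psi>: "briot_bouquet_solution \<phi> \<psi>" and c: "\<psi> has_fps_expansion c"
begin

lemma hol\<psi>: "\<psi> holomorphic_on unit_disc" and \<psi>0: "\<psi> 0 = 1"
  using \<psi> by (auto simp: briot_bouquet_solution_def)

text \<open>The coefficient bound is applied to p and also to \<psi>, which is subordinate to
  itself; the resulting bound on the c_m makes the series of |c_m|^2 / m^2 converge.\<close>

lemma log_coeff_bound_convex:
  assumes cv: "convex_function \<psi>" and f: "f \<in> class_C \<phi>" and m: "m \<ge> 1"
  shows "norm (log_coeff f m) \<le> norm (deriv \<psi> 0) / (2 * real m)"
    and "norm (fps_nth c m) \<le> norm (deriv \<psi> 0)"
    and "(\<Sum>k<n. (norm (log_coeff f (Suc k)))\<^sup>2)
          \<le> 1/4 * (\<Sum>k<n. (norm (fps_nth c (Suc k)))\<^sup>2 / (real (Suc k))\<^sup>2)"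
proof -
  have inj: "inj_on \<psi> unit_disc" using cv by (simp add: convex_function_def)
  have nz: "deriv \<psi> z \<noteq> 0" if "z \<in> unit_disc" for z
    using holomorphic_injective_imp_regular[OF hol\<psi> open_ball inj that] .
  obtain p L where p: "p holomorphic_on unit_disc" "p 0 = 1"
    "subordinate (\<lambda>z. p z + z * deriv p z / p z) \<phi>"
    and L: "L holomorphic_on unit_disc" "L 0 = 0"
    "\<And>z. z \<in> unit_disc \<Longrightarrow> f z = z * exp (L z)"
    "\<And>z. z \<in> unit_disc \<Longrightarrow> p z = 1 + z * deriv L z"
    using class_C_log_derivative[OF \<phi> f] by blast
  define P where "P = fps_expansion p 0"
  have P: "p has_fps_expansion P"
    unfolding P_def by (rule holomorphic_imp_has_fps_expansion[OF p(1)]) simp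
  have sub: "subordinate p \<psi>"
    by (rule briot_bouquet_best_dominant[OF \<phi> \<psi> inj p])
  have lc: "log_coeff f k = fps_nth P k / (2 * of_nat k)" if "k \<ge> 1" for k
    using log_coeff_eq[OF L(1-3) L(4) P that] .
  have bound: "norm (fps_nth A m) \<le> norm (deriv \<psi> 0)"
    if "q holomorphic_on unit_disc" "q has_fps_expansion A" "subordinate q \<psi>" for q A
    using support_coeff_bound[OF hol\<psi> nz convex_function_support[OF cv] that m] .
  show "norm (log_coeff f m) \<le> norm (deriv \<psi> 0) / (2 * real m)"
    using bound[OF p(1) P sub] m by (simp add: lc norm_divide norm_mult divide_right_mono)
  have "subordinate \<psi> \<psi>"
    unfolding subordinate_def by (intro exI[of _ "\<lambda>z. z"]) auto
  then show "norm (fps_nth c m) \<le> norm (deriv \<psi> 0)"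
    using bound[OF hol\<psi> c] by simp
  \<comment> \<open>Both constant terms are 1, so they drop out of the inequality for n + 1
    coefficients and leave the sums over indices from 1 on.\<close>
  have P0: "fps_nth P 0 = fps_nth c 0"
    using has_fps_expansion_imp_0_eq_fps_nth_0[OF P] has_fps_expansion_imp_0_eq_fps_nth_0[OF c] p(2) \<psi>0 by simp
  have le: "(\<Sum>k<n. (norm (fps_nth P (Suc k)))\<^sup>2) \<le> (\<Sum>k<n. (norm (fps_nth c (Suc k)))\<^sup>2)" for n
    using rogosinski_square_sum[OF p(1) P hol\<psi> c sub, of "Suc n"] P0
    by (simp add: sum.lessThan_Suc_shift del: sum.lessThan_Suc)
  have "(\<Sum>k<n. (norm (log_coeff f (Suc k)))\<^sup>2) = (\<Sum>k<n. 1 / (4 * (real (Suc k))\<^sup>2) * (norm (fps_nth P (Suc k)))\<^sup>2)"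
    by (intro sum.cong) (auto simp: lc norm_divide norm_mult power_divide power_mult_distrib simp del: of_nat_Suc)
  also have "\<dots> \<le> (\<Sum>k<n. 1 / (4 * (real (Suc k))\<^sup>2) * (norm (fps_nth c (Suc k)))\<^sup>2)"
    by (rule weighted_sum_mono[OF le]) (auto simp: decseq_Suc_iff intro!: divide_left_mono power_mono)
  also have "\<dots> = 1/4 * (\<Sum>k<n. (norm (fps_nth c (Suc k)))\<^sup>2 / (real (Suc k))\<^sup>2)"
    by (simp add: sum_distrib_left)
  finally show "(\<Sum>k<n. (norm (log_coeff f (Suc k)))\<^sup>2)
          \<le> 1/4 * (\<Sum>k<n. (norm (fps_nth c (Suc k)))\<^sup>2 / (real (Suc k))\<^sup>2)" .
qed

lemma log_coeff_square_sum_convex: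
  assumes cv: "convex_function \<psi>" and f: "f \<in> class_C \<phi>"
  shows "summable (\<lambda>m. (norm (log_coeff f (Suc m)))\<^sup>2)"
    and "summable (\<lambda>m. (norm (fps_nth c (Suc m)))\<^sup>2 / (real (Suc m))\<^sup>2)"
    and "(\<Sum>m. (norm (log_coeff f (Suc m)))\<^sup>2)
            \<le> 1/4 * (\<Sum>m. (norm (fps_nth c (Suc m)))\<^sup>2 / (real (Suc m))\<^sup>2)"
proof -
  note b = log_coeff_bound_convex[OF cv f]
  show s1: "summable (\<lambda>m. (norm (log_coeff f (Suc m)))\<^sup>2)"
  proof (rule summable_comparison_test[OF _ summable_inverse_squares_Suc])
    show "\<exists>N. \<forall>m\<ge>N. norm ((norm (log_coeff f (Suc m)))\<^sup>2) \<le> (norm (deriv \<psi> 0) / 2)\<^sup>2 / (real (Suc m))\<^sup>2"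
    proof (intro exI allI impI)
      fix m
      show "norm ((norm (log_coeff f (Suc m)))\<^sup>2) \<le> (norm (deriv \<psi> 0) / 2)\<^sup>2 / (real (Suc m))\<^sup>2"
      proof -
        have "norm (log_coeff f (Suc m)) \<le> norm (deriv \<psi> 0) / (2 * real (Suc m))"
          by (rule b(1)) simp
        then have "(norm (log_coeff f (Suc m)))\<^sup>2 \<le> (norm (deriv \<psi> 0) / (2 * real (Suc m)))\<^sup>2"
          by (rule power_mono) simp
        then show ?thesis
          by (simp add: power_divide power_mult_distrib del: of_nat_Suc)
      qed
    qed
  qed
  show s2: "summable (\<lambda>m. (norm (fps_nth c (Suc m)))\<^sup>2 / (real (Suc m))\<^sup>2)"
  proof (rule summable_comparison_test[OF _ summable_inverse_squares_Suc])
    show "\<exists>N. \<forall>m\<ge>N. norm ((norm (fps_nth c (Suc m)))\<^sup>2 / (real (Suc m))\<^sup>2) \<le> (norm (deriv \<psi> 0))\<^sup>2 / (real (Suc m))\<^sup>2"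
      using b(2) by (auto intro!: divide_right_mono power_mono)
  qed
  show "(\<Sum>m. (norm (log_coeff f (Suc m)))\<^sup>2)
            \<le> 1/4 * (\<Sum>m. (norm (fps_nth c (Suc m)))\<^sup>2 / (real (Suc m))\<^sup>2)"
  proof (rule suminf_le_const[OF s1])
    fix n
    have "(\<Sum>k<n. (norm (fps_nth c (Suc k)))\<^sup>2 / (real (Suc k))\<^sup>2)
        \<le> (\<Sum>m. (norm (fps_nth c (Suc m)))\<^sup>2 / (real (Suc m))\<^sup>2)"
      by (rule sum_le_suminf[OF s2]) auto
    then show "(\<Sum>k<n. (norm (log_coeff f (Suc k)))\<^sup>2)
            \<le> 1/4 * (\<Sum>m. (norm (fps_nth c (Suc m)))\<^sup>2 / (real (Suc m))\<^sup>2)"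
      using b(3)[of 1 n] by simp
  qed
qed

text \<open>The coefficient bound is applied to log (f(z) / z), whose coefficients are 2 gamma_m,
  and to its dominant \<open>G\<close>, for which \<open>deriv G 0 = deriv \<psi> 0\<close>.\<close>

lemma log_coeff_bound_starlike:
  assumes st: "starlike_function_wrt 1 \<psi>" and f: "f \<in> class_C \<phi>" and m: "m \<ge> 1"
  shows "norm (log_coeff f m) \<le> norm (deriv \<psi> 0) / 2"
proof -
  obtain p L where p: "p holomorphic_on unit_disc" "p 0 = 1"
    "subordinate (\<lambda>z. p z + z * deriv p z / p z) \<phi>"
    and L: "L holomorphic_on unit_disc" "L 0 = 0"
    "\<And>z. z \<in> unit_disc \<Longrightarrow> f z = z * exp (L z)"
    "\<And>z. z \<in> unit_disc \<Longrightarrow> p z = 1 + z * deriv L z"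
    using class_C_log_derivative[OF \<phi> f] by blast
  obtain G where G: "G holomorphic_on unit_disc" "G 0 = 0"
    "\<And>z. z \<in> unit_disc \<Longrightarrow> z * deriv G z = \<psi> z - 1"
    using log_derivative_primitive[OF hol\<psi> \<psi>0] by metis
  interpret starlike_primitive \<psi> G 1
    by standard (use st \<psi>0 G in auto)
  have "subordinate L G"
  proof (rule subordinate_primitive[of L p])
    show "subordinate p \<psi>"
      by (rule briot_bouquet_best_dominant[OF \<phi> \<psi> inj\<psi> p])
  qed (use L G in auto)
  then have "norm (fps_nth (Abs_fps (\<lambda>m. 2 * log_coeff f m)) m) \<le> norm (deriv G 0)"
    by (intro support_coeff_bound[OF G(1) deriv_nonzero support L(1) log_coeff_has_fps_expansion[OF L(1-3)] _ m])
  then show ?thesis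
    by (simp add: deriv_G_0 norm_mult)
qed

end

lemma best_possible_boundI:
  assumes "f \<in> K" "S f = b" "\<And>g. g \<in> K \<Longrightarrow> S g \<le> b"
  shows "best_possible_bound K S b"
  using assms by (auto simp: best_possible_bound_def)

theorem theorem3p4:
  fixes \<phi> \<psi> :: "complex \<Rightarrow> complex" and B c :: "complex fps"
  assumes "ma_minda \<phi>" and "convex_function \<phi>"
    and "\<phi> has_fps_expansion B"
    and "briot_bouquet_solution \<phi> \<psi>"
    and "\<psi> has_fps_expansion c"
  shows
    "(convex_function \<psi> \<longrightarrow>
       (\<forall>f\<in>class_C \<phi>.
          (\<forall>m\<ge>1. norm (log_coeff f m) \<le> norm (fps_nth B 1) / (4 * real m)) \<and>
          (\<forall>n\<ge>1. (\<Sum>m=1..n. (norm (log_coeff f m))\<^sup>2)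
                    \<le> 1/4 * (\<Sum>m=1..n. (norm (fps_nth c m))\<^sup>2 / (real m)\<^sup>2)) \<and>
          summable (\<lambda>m. (norm (log_coeff f (Suc m)))\<^sup>2) \<and>
          summable (\<lambda>m. (norm (fps_nth c (Suc m)))\<^sup>2 / (real (Suc m))\<^sup>2) \<and>
          (\<Sum>m. (norm (log_coeff f (Suc m)))\<^sup>2)
            \<le> 1/4 * (\<Sum>m. (norm (fps_nth c (Suc m)))\<^sup>2 / (real (Suc m))\<^sup>2))) \<and>
     (starlike_function_wrt 1 \<psi> \<longrightarrow>
       (\<forall>f\<in>class_C \<phi>. \<forall>m\<ge>1. norm (log_coeff f m) \<le> norm (fps_nth B 1) / 4)) \<and>
     (\<exists>f\<^sub>0. has_log_derivative f\<^sub>0 \<psi>) \<and>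
     (\<forall>f\<^sub>0. has_log_derivative f\<^sub>0 \<psi> \<longrightarrow>
        f\<^sub>0 \<in> class_C \<phi> \<and>
        (convex_function \<psi> \<longrightarrow>
          (\<forall>m\<ge>1. norm (log_coeff f\<^sub>0 m) = norm (fps_nth B 1) / (4 * real m) \<longrightarrow>
             best_possible_bound (class_C \<phi>) (\<lambda>g. norm (log_coeff g m))
               (norm (fps_nth B 1) / (4 * real m))) \<and>
          ((\<Sum>m. (norm (log_coeff f\<^sub>0 (Suc m)))\<^sup>2)
              = 1/4 * (\<Sum>m. (norm (fps_nth c (Suc m)))\<^sup>2 / (real (Suc m))\<^sup>2) \<longrightarrow>
             best_possible_bound (class_C \<phi>) (\<lambda>g. \<Sum>m. (norm (log_coeff g (Suc m)))\<^sup>2)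
               (1/4 * (\<Sum>m. (norm (fps_nth c (Suc m)))\<^sup>2 / (real (Suc m))\<^sup>2)))) \<and>
        (starlike_function_wrt 1 \<psi> \<longrightarrow>
          (\<forall>m\<ge>1. norm (log_coeff f\<^sub>0 m) = norm (fps_nth B 1) / 4 \<longrightarrow>
             best_possible_bound (class_C \<phi>) (\<lambda>g. norm (log_coeff g m))
               (norm (fps_nth B 1) / 4))))"
proof -
  interpret briot_bouquet_data \<phi> \<psi> c
    using assms by unfold_locales (auto simp: ma_minda_def)
  have B: "norm (fps_nth B 1) = 2 * norm (deriv \<psi> 0)"
    using has_fps_expansion_nth_1[OF assms(3)] briot_bouquet_deriv_0[OF assms(4)] by (simp add: norm_mult)
  have 1: "norm (log_coeff f m) \<le> norm (fps_nth B 1) / (4 * real m)"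
    if "convex_function \<psi>" "f \<in> class_C \<phi>" "m \<ge> 1" for f m
    using log_coeff_bound_convex(1)[OF that] unfolding B by simp
  have 2: "(\<Sum>m=1..n. (norm (log_coeff f m))\<^sup>2) \<le> 1/4 * (\<Sum>m=1..n. (norm (fps_nth c m))\<^sup>2 / (real m)\<^sup>2)"
    if "convex_function \<psi>" "f \<in> class_C \<phi>" for f n
    using log_coeff_bound_convex(3)[OF that, of 1 n]
    by (simp add: sum.atLeast1_atMost_eq)
  note 3 = log_coeff_square_sum_convex
  have 4: "norm (log_coeff f m) \<le> norm (fps_nth B 1) / 4"
    if "starlike_function_wrt 1 \<psi>" "f \<in> class_C \<phi>" "m \<ge> 1" for f m
    using log_coeff_bound_starlike[OF that] unfolding B by simp
  have 5: "\<exists>f. has_log_derivative f \<psi>"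
    by (rule has_log_derivative_exists[OF hol\<psi> \<psi>0])
  have 6: "f \<in> class_C \<phi>" if "has_log_derivative f \<psi>" for f
    by (rule has_log_derivative_class_C[OF \<psi> that])
  show ?thesis
    by (intro conjI impI ballI allI) (use 1 2 3 4 5 6 in \<open>auto intro!: best_possible_boundI\<close>)
qed

end
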